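(* Suppose that a linear partial monitoring game (with domain $\mathcal D$ and Legendre potential $F$ satisfying the standing assumptions in the context) has an information ratio of $(\alpha,\beta,\lambda)$ with $\lambda>1$, where $\beta>0$ and $\operatorname{diam}(\mathcal D)>0$. Let $n\ge1$ and $\epsilon>0$. Then the exploration-by-optimisation algorithm described in the context (with either the MD or the FTRL update), run with precision $\epsilon$ and learning rate $$\eta=\lambda\left(\frac{\operatorname{diam}(\mathcal D)}{\beta n}\right)^{1-1/\lambda},$$ satisfies, for every sequence $(z_t)_{t=1}^n$ in $\mathcal Z$, $$\mathfrak R_n\le(\epsilon+\epsilon_{\mathcal D}+\alpha)n+\operatorname{diam}(\mathcal D)^{\frac1\lambda}(\beta n)^{1-\frac1\lambda}.$$
   Context: A linear partial monitoring game is given by an action set $\mathcal A\subset\mathbb R^d$, a signal set $\Sigma$, a latent set $\mathcal Z$, a signal function $\Phi:\mathcal A\times\mathcal Z\to\Sigma$, written $\Phi_a(z)$, and a loss function $\ell:\mathcal Z\to[0,1]^d$; $\Phi$ and $\ell$ are known to the learner. An adversary secretly fixes $(z_t)_{t=1}^n$ in $\mathcal Z$. In round $t$ the learner chooses a distribution $P_t$ on $\mathcal A$ depending on the past actions and signals, samples $A_t\sim P_t$ and observes $\sigma_t=\Phi_{A_t}(z_t)$. The regret is $\mathfrak R_n=\max_{a\in\mathcal A}\mathbb E[\sum_{t=1}^n\langle A_t-a,\ell(z_t)\rangle]$. Standing assumptions. $F:\mathbb R^d\to\mathbb R\cup\{\infty\}$ is Legendre (proper, convex, lower semi-continuous, essentially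 smooth and essentially strictly convex). $\mathcal D\subset\operatorname{conv}(\mathcal A)$ is compact, convex and has non-empty relative interior. Moreover: (a) $1<|\mathcal A|<\infty$; (b) $\langle a,\ell(z)\rangle\in[0,1]$ for all $a\in\mathcal A$, $z\in\mathcal Z$; (c) $\mathcal D\subset\operatorname{dom}(F)=\{x:F(x)<\infty\}$; (d) $\operatorname{diam}(\mathcal D)=\sup_{x,y\in\mathcal D}(F(x)-F(y))<\infty$. Notation. $\mathcal P$ is the set of probability distributions on $\mathcal A$ and $\mathcal P_+=\{p\in\mathcal P: p(a)>0\ \forall a\in\mathcal A\}$. $F^\star(u)=\sup_{x\in\mathbb R^d}\langle u,x\rangle-F(x)$. Bregman divergences: $\operatorname{D}(p,q)=F(p)-F(q)-\langle\nabla F(q),p-q\rangle$ and $\operatorname{D}_\star(x,y)=F^\star(x)-F^\star(y)-\langle\nabla F^\star(y),x-y\rangle$. If $F$ is not differentiable at $q$, then $\langle\nabla F(q),p-q\rangle$ is read as $\lim_{h\to0^+}(F(q+h(p-q))-F(q))/h$. $\operatorname{dom}(\nabla F)$ is the set where $F$ is differentiable. For $q\in\mathcal D\cap\operatorname{dom}(\nabla F)$, $\Psi_q(x)=\operatorname{D}_\star(\nabla F(q)-x,\nabla F(q))$. $\mathcal V$ is the set of finitely supported probability distributions on $\mathcal Z\times\mathcal D$. $\mathcal G$ is the set of all functions from $\mathcal A\times\Sigma$ to $\mathbb R^d$. $\epsilon_{\mathcal D}=\max_{a\in\mathcal A}\min_{b\in\mathcal D}\sup_{z\in\mathcal Z}\langle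 b-a,\ell(z)\rangle$. Information ratio. For $\alpha\in\mathbb R$, $\beta\ge0$, $\lambda\ge1$, the game has an information ratio of $(\alpha,\beta,\lambda)$ if for any $\nu\in\mathcal V$ there exists $p\in\mathcal P$ such that when $(Z,A^*,A)$ has law $\nu\otimes p$, $$\mathbb E[\langle A-A^*,\ell(Z)\rangle]\le\alpha+\beta^{1-1/\lambda}\,\big(\mathbb E[\operatorname{D}(\mathbb E[A^*\mid\Phi_A(Z),A],\mathbb E[A^*])]\big)^{1/\lambda}.$$ Optimisation problem. For $\eta>0$, $q\in\mathcal D\cap\operatorname{dom}(\nabla F)$, $z\in\mathcal Z$, $a^*\in\mathcal D$, $p\in\mathcal P_+$, $g\in\mathcal G$, $$\Lambda_{q,\eta}(z,a^*,p,g)=\sum_{a\in\mathcal A}p(a)\langle a-a^*,\ell(z)\rangle+\Big\langle a^*-q,\sum_{a\in\mathcal A}g(a,\Phi_a(z))\Big\rangle+\frac1\eta\sum_{a\in\mathcal A}p(a)\Psi_q\left(\frac{\eta g(a,\Phi_a(z))}{p(a)}\right),$$ $$\Lambda^*_\eta=\sup_{q\in\mathcal D\cap\operatorname{dom}(\nabla F)}\ \inf_{p\in\mathcal P_+,\,g\in\mathcal G}\ \sup_{z\in\mathcal Z,\,a^*\in\mathcal D}\Lambda_{q,\eta}(z,a^*,p,g).$$ Exploration by optimisation, with learning rate $\eta>0$ and precision $\epsilon>0$. Set $Q_1=\arg\min_{q\in\mathcal D}F(q)$. In each round $t=1,\dots,n$: choose (as a function of the history) $P_t\in\mathcal P_+$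 and $G_t\in\mathcal G$ such that $\sup_{z\in\mathcal Z,a^*\in\mathcal D}\Lambda_{Q_t,\eta}(z,a^*,P_t,G_t)\le\Lambda^*_\eta+\epsilon$; sample $A_t\sim P_t$ and observe $\sigma_t=\Phi_{A_t}(z_t)$; set $\hat\ell_t=G_t(A_t,\sigma_t)/P_t(A_t)$; update either by (MD) $Q_{t+1}=\arg\min_{q\in\mathcal D}\langle q,\hat\ell_t\rangle+\frac1\eta\operatorname{D}(q,Q_t)$, in every round, or by (FTRL) $Q_{t+1}=\arg\min_{q\in\mathcal D}\sum_{s=1}^t\langle q,\hat\ell_s\rangle+\frac{F(q)}\eta$, in every round. It is understood that the iterates $Q_t$ lie in $\mathcal D\cap\operatorname{dom}(\nabla F)$, so that $\Lambda_{Q_t,\eta}$ is defined. *)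

theory Defs
  imports "HOL-Probability.Probability"
begin

section \<open>Extended-real convex analysis\<close>

text \<open>Functions \<open>\<real>\<^sup>d \<rightarrow> \<real> \<union> {\<infinity>}\<close> are \<^typ>\<open>ereal\<close>-valued functions that avoid \<open>-\<infinity>\<close>;
  the latter is part of \<open>proper_fun\<close>.\<close>

definition edom :: "('v \<Rightarrow> ereal) \<Rightarrow> 'v set" where
  "edom F = {x. F x < \<infinity>}"

definition proper_fun :: "('v \<Rightarrow> ereal) \<Rightarrow> bool" where
  "proper_fun F \<longleftrightarrow> (\<forall>x. F x \<noteq> -\<infinity>) \<and> edom F \<noteq> {}"

definition convex_fun :: "('v::real_vector \<Rightarrow> ereal) \<Rightarrow> bool" where
  "convex_fun F \<longleftrightarrow> (\<forall>x y. \<forall>u\<ge>0. \<forall>v\<ge>0. u + v = 1 \<longrightarrow>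
     F (u *\<^sub>R x + v *\<^sub>R y) \<le> ereal u * F x + ereal v * F y)"

definition strictly_convex_fun_on :: "'v::real_vector set \<Rightarrow> ('v \<Rightarrow> ereal) \<Rightarrow> bool" where
  "strictly_convex_fun_on C F \<longleftrightarrow> (\<forall>x\<in>C. \<forall>y\<in>C. \<forall>u>0. \<forall>v>0. x \<noteq> y \<longrightarrow> u + v = 1 \<longrightarrow>
     F (u *\<^sub>R x + v *\<^sub>R y) < ereal u * F x + ereal v * F y)"

definition lower_semicontinuous :: "('v::topological_space \<Rightarrow> ereal) \<Rightarrow> bool" where
  "lower_semicontinuous F \<longleftrightarrow> (\<forall>x. F x \<le> Liminf (at x) F)"

definition has_gradient :: "('v::real_inner \<Rightarrow> ereal) \<Rightarrow> 'v \<Rightarrow> 'v \<Rightarrow> bool" where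
  "has_gradient F x v \<longleftrightarrow>
     (\<forall>\<^sub>F y in nhds x. \<bar>F y\<bar> \<noteq> \<infinity>) \<and> GDERIV (\<lambda>y. real_of_ereal (F y)) x :> v"

definition dom_grad :: "('v::real_inner \<Rightarrow> ereal) \<Rightarrow> 'v set" where
  "dom_grad F = {x. \<exists>v. has_gradient F x v}"

definition grad :: "('v::real_inner \<Rightarrow> ereal) \<Rightarrow> 'v \<Rightarrow> 'v" where
  "grad F x = (THE v. has_gradient F x v)"

definition subdifferential :: "('v::real_inner \<Rightarrow> ereal) \<Rightarrow> 'v \<Rightarrow> 'v set" where
  "subdifferential F x = {v. \<forall>y. F x + ereal (v \<bullet> (y - x)) \<le> F y}"

text \<open>Essential smoothness and essential strict convexity in the sense of Rockafellar.\<close>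

definition essentially_smooth :: "('v::real_inner \<Rightarrow> ereal) \<Rightarrow> bool" where
  "essentially_smooth F \<longleftrightarrow>
     interior (edom F) \<noteq> {} \<and> interior (edom F) \<subseteq> dom_grad F \<and>
     (\<forall>X x. (\<forall>i::nat. X i \<in> interior (edom F)) \<longrightarrow> X \<longlonglongrightarrow> x \<longrightarrow>
        x \<in> frontier (interior (edom F)) \<longrightarrow>
        filterlim (\<lambda>i. norm (grad F (X i))) at_top sequentially)"

definition essentially_strictly_convex :: "('v::real_inner \<Rightarrow> ereal) \<Rightarrow> bool" where
  "essentially_strictly_convex F \<longleftrightarrow>
     (\<forall>C. convex C \<longrightarrow> C \<subseteq> {x. subdifferential F x \<noteq> {}} \<longrightarrow> strictly_convex_fun_on C F)"

definition legendre :: "('v::real_inner \<Rightarrow> ereal) \<Rightarrow> bool" where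
  "legendre F \<longleftrightarrow> proper_fun F \<and> convex_fun F \<and> lower_semicontinuous F \<and>
     essentially_smooth F \<and> essentially_strictly_convex F"

definition fenchel_conj :: "('v::real_inner \<Rightarrow> ereal) \<Rightarrow> 'v \<Rightarrow> ereal" where
  "fenchel_conj F u = (SUP x. ereal (u \<bullet> x) - F x)"

text \<open>The difference quotient of a convex function is monotone, so the limit below exists
  in \<open>[-\<infinity>, \<infinity>]\<close> whenever \<^term>\<open>F q\<close> is finite. It may equal \<open>-\<infinity>\<close>, and the Bregman divergence
  is then \<open>\<infinity>\<close>.\<close>

definition grad_pairing :: "('v::real_inner \<Rightarrow> ereal) \<Rightarrow> 'v \<Rightarrow> 'v \<Rightarrow> ereal" where
  "grad_pairing F q d =
     (if q \<in> dom_grad F then ereal (grad F q \<bullet> d)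
      else Lim (at_right 0) (\<lambda>h. (F (q + h *\<^sub>R d) - F q) / ereal h))"

definition bregman :: "('v::real_inner \<Rightarrow> ereal) \<Rightarrow> 'v \<Rightarrow> 'v \<Rightarrow> ereal" where
  "bregman F p q = F p - F q - grad_pairing F q (p - q)"

definition bregman_dual :: "('v::real_inner \<Rightarrow> ereal) \<Rightarrow> 'v \<Rightarrow> 'v \<Rightarrow> ereal" where
  "bregman_dual F x y = fenchel_conj F x - fenchel_conj F y
     - ereal (grad (fenchel_conj F) y \<bullet> (x - y))"

definition Psi :: "('v::real_inner \<Rightarrow> ereal) \<Rightarrow> 'v \<Rightarrow> 'v \<Rightarrow> ereal" where
  "Psi F q x = bregman_dual F (grad F q - x) (grad F q)"

definition potential_diam :: "('v \<Rightarrow> ereal) \<Rightarrow> 'v set \<Rightarrow> ereal" where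
  "potential_diam F D = (SUP x\<in>D. SUP y\<in>D. F x - F y)"

definition ereal_powr :: "ereal \<Rightarrow> real \<Rightarrow> ereal" where
  "ereal_powr x r = (if x = \<infinity> then \<infinity> else ereal (real_of_ereal x powr r))"


section \<open>Linear partial monitoring games\<close>

record ('d, 'z, 's) pm_game =
  actions :: "(real ^ 'd::finite) set"
  latent :: "'z set"
  signals :: "'s set"
  signal :: "real ^ 'd \<Rightarrow> 'z \<Rightarrow> 's"
  loss :: "'z \<Rightarrow> real ^ 'd"

definition linear_pm_game :: "('d::finite, 'z, 's) pm_game \<Rightarrow> bool" where
  "linear_pm_game \<G> \<longleftrightarrow>
     (\<forall>a\<in>actions \<G>. \<forall>z\<in>latent \<G>. signal \<G> a z \<in> signals \<G>) \<and>
     (\<forall>z\<in>latent \<G>. \<forall>i. 0 \<le> loss \<G> z $ i \<and> loss \<G> z $ i \<le> 1)"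

definition standing_assumptions ::
    "('d::finite, 'z, 's) pm_game \<Rightarrow> (real ^ 'd \<Rightarrow> ereal) \<Rightarrow> (real ^ 'd) set \<Rightarrow> bool" where
  "standing_assumptions \<G> F D \<longleftrightarrow>
     legendre F \<and>
     D \<subseteq> convex hull (actions \<G>) \<and> compact D \<and> convex D \<and> rel_interior D \<noteq> {} \<and>
     finite (actions \<G>) \<and> 1 < card (actions \<G>) \<and>
     (\<forall>a\<in>actions \<G>. \<forall>z\<in>latent \<G>. 0 \<le> a \<bullet> loss \<G> z \<and> a \<bullet> loss \<G> z \<le> 1) \<and>
     D \<subseteq> edom F \<and>
     potential_diam F D < \<infinity>"

text \<open>Under the standing assumptions the supremum below is a Lipschitz function of \<open>b\<close>, so the
  infimum over the compact set \<open>D\<close> is a minimum.\<close>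

definition domain_gap :: "('d::finite, 'z, 's) pm_game \<Rightarrow> (real ^ 'd) set \<Rightarrow> real" where
  "domain_gap \<G> D =
     Max ((\<lambda>a. INF b\<in>D. SUP z\<in>latent \<G>. (b - a) \<bullet> loss \<G> z) ` actions \<G>)"


subsection \<open>Information ratio\<close>

text \<open>A sample point is \<open>((z, b), a)\<close>, standing for \<open>((Z, A\<^sup>*), A)\<close>. Its law has finite support,
  so conditional expectations are expectations under the elementary conditional law.\<close>

definition posterior_mean ::
    "('d::finite, 'z, 's) pm_game \<Rightarrow> (('z \<times> (real ^ 'd)) \<times> (real ^ 'd)) pmf \<Rightarrow>
     ('z \<times> (real ^ 'd)) \<times> (real ^ 'd) \<Rightarrow> real ^ 'd" where
  "posterior_mean \<G> M \<omega> =
     (let obs = (\<lambda>((z, b), a). (signal \<G> a z, a))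
      in measure_pmf.expectation (cond_pmf M {\<omega>'. obs \<omega>' = obs \<omega>}) (\<lambda>((z, b), a). b))"

definition information_gain ::
    "('d::finite, 'z, 's) pm_game \<Rightarrow> (real ^ 'd \<Rightarrow> ereal) \<Rightarrow>
     (('z \<times> (real ^ 'd)) \<times> (real ^ 'd)) pmf \<Rightarrow> ereal" where
  "information_gain \<G> F M =
     (\<Sum>\<omega>\<in>set_pmf M. ereal (pmf M \<omega>) *
        bregman F (posterior_mean \<G> M \<omega>) (measure_pmf.expectation M (\<lambda>((z, b), a). b)))"

text \<open>The case distinction makes \<open>\<beta>\<^bsup>1-1/lam\<^esup> = 1\<close> for \<open>lam = 1\<close> also if \<open>\<beta> = 0\<close>,
  where \<^const>\<open>powr\<close> yields 0.\<close>

definition has_information_ratio ::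
    "('d::finite, 'z, 's) pm_game \<Rightarrow> (real ^ 'd \<Rightarrow> ereal) \<Rightarrow> (real ^ 'd) set \<Rightarrow>
     real \<Rightarrow> real \<Rightarrow> real \<Rightarrow> bool" where
  "has_information_ratio \<G> F D \<alpha> \<beta> lam \<longleftrightarrow>
     (\<forall>\<nu>. finite (set_pmf \<nu>) \<and> set_pmf \<nu> \<subseteq> latent \<G> \<times> D \<longrightarrow>
       (\<exists>p. set_pmf p \<subseteq> actions \<G> \<and>
         ereal (measure_pmf.expectation (pair_pmf \<nu> p) (\<lambda>((z, b), a). (a - b) \<bullet> loss \<G> z))
         \<le> ereal \<alpha> + ereal (if lam = 1 then 1 else \<beta> powr (1 - 1 / lam)) *
             ereal_powr (information_gain \<G> F (pair_pmf \<nu> p)) (1 / lam)))"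


subsection \<open>The optimisation problem\<close>

definition Lambda ::
    "('d::finite, 'z, 's) pm_game \<Rightarrow> (real ^ 'd \<Rightarrow> ereal) \<Rightarrow> real ^ 'd \<Rightarrow> real \<Rightarrow>
     'z \<Rightarrow> real ^ 'd \<Rightarrow> (real ^ 'd) pmf \<Rightarrow> (real ^ 'd \<Rightarrow> 's \<Rightarrow> real ^ 'd) \<Rightarrow> ereal" where
  "Lambda \<G> F q \<eta> z b p g =
     ereal (\<Sum>a\<in>actions \<G>. pmf p a * ((a - b) \<bullet> loss \<G> z))
     + ereal ((b - q) \<bullet> (\<Sum>a\<in>actions \<G>. g a (signal \<G> a z)))
     + ereal (1 / \<eta>) * (\<Sum>a\<in>actions \<G>. ereal (pmf p a) *
         Psi F q ((\<eta> / pmf p a) *\<^sub>R g a (signal \<G> a z)))"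

definition Lambda_sup ::
    "('d::finite, 'z, 's) pm_game \<Rightarrow> (real ^ 'd \<Rightarrow> ereal) \<Rightarrow> (real ^ 'd) set \<Rightarrow> real ^ 'd \<Rightarrow> real \<Rightarrow>
     (real ^ 'd) pmf \<Rightarrow> (real ^ 'd \<Rightarrow> 's \<Rightarrow> real ^ 'd) \<Rightarrow> ereal" where
  "Lambda_sup \<G> F D q \<eta> p g = (SUP z\<in>latent \<G>. SUP b\<in>D. Lambda \<G> F q \<eta> z b p g)"

definition Lambda_star ::
    "('d::finite, 'z, 's) pm_game \<Rightarrow> (real ^ 'd \<Rightarrow> ereal) \<Rightarrow> (real ^ 'd) set \<Rightarrow> real \<Rightarrow> ereal" where
  "Lambda_star \<G> F D \<eta> =
     (SUP q\<in>D \<inter> dom_grad F. INF p\<in>{p. set_pmf p = actions \<G>}. INF g. Lambda_sup \<G> F D q \<eta> p g)"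


subsection \<open>Interaction protocol and regret\<close>

text \<open>A history lists the past (action, signal) pairs, oldest first. A policy maps the history
  before a round to the distribution of the action played in that round. The latent sequence
  is indexed from 1.\<close>

type_synonym ('d, 's) history = "((real ^ 'd) \<times> 's) list"

definition histories :: "('d::finite, 'z, 's) pm_game \<Rightarrow> ('d, 's) history set" where
  "histories \<G> = lists {(a, signal \<G> a z) | a z. a \<in> actions \<G> \<and> z \<in> latent \<G>}"

primrec history_pmf ::
    "('d::finite, 'z, 's) pm_game \<Rightarrow> (('d, 's) history \<Rightarrow> (real ^ 'd) pmf) \<Rightarrow> (nat \<Rightarrow> 'z) \<Rightarrow>
     nat \<Rightarrow> ('d, 's) history pmf" where
  "history_pmf \<G> P z 0 = return_pmf []"
| "history_pmf \<G> P z (Suc t) =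
     bind_pmf (history_pmf \<G> P z t)
       (\<lambda>h. map_pmf (\<lambda>a. h @ [(a, signal \<G> a (z (Suc t)))]) (P h))"

definition regret ::
    "('d::finite, 'z, 's) pm_game \<Rightarrow> (('d, 's) history \<Rightarrow> (real ^ 'd) pmf) \<Rightarrow> (nat \<Rightarrow> 'z) \<Rightarrow>
     nat \<Rightarrow> real" where
  "regret \<G> P z n =
     Max ((\<lambda>a. measure_pmf.expectation (history_pmf \<G> P z n)
                (\<lambda>h. \<Sum>t=1..n. (fst (h ! (t - 1)) - a) \<bullet> loss \<G> (z t))) ` actions \<G>)"


subsection \<open>Exploration by optimisation\<close>

datatype update_rule = MD | FTRL

text \<open>In the following, \<open>P h\<close>, \<open>E h\<close> and \<open>Q h\<close> are the distribution, the estimation function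
  and the iterate that are used in the round following the history \<open>h\<close>.\<close>

definition loss_estimate ::
    "(('d::finite, 's) history \<Rightarrow> (real ^ 'd) pmf) \<Rightarrow>
     (('d, 's) history \<Rightarrow> real ^ 'd \<Rightarrow> 's \<Rightarrow> real ^ 'd) \<Rightarrow>
     ('d, 's) history \<Rightarrow> real ^ 'd \<Rightarrow> 's \<Rightarrow> real ^ 'd" where
  "loss_estimate P E h a \<sigma> = (1 / pmf (P h) a) *\<^sub>R E h a \<sigma>"

text \<open>The function of \<open>q\<close> minimised at the end of a round that starts with history \<open>h\<close> and in
  which action \<open>a\<close> is played and signal \<open>\<sigma>\<close> is observed.\<close>

primrec update_objective ::
    "update_rule \<Rightarrow> (real ^ 'd::finite \<Rightarrow> ereal) \<Rightarrow> real \<Rightarrow>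
     (('d, 's) history \<Rightarrow> (real ^ 'd) pmf) \<Rightarrow>
     (('d, 's) history \<Rightarrow> real ^ 'd \<Rightarrow> 's \<Rightarrow> real ^ 'd) \<Rightarrow>
     (('d, 's) history \<Rightarrow> real ^ 'd) \<Rightarrow>
     ('d, 's) history \<Rightarrow> real ^ 'd \<Rightarrow> 's \<Rightarrow> real ^ 'd \<Rightarrow> ereal" where
  "update_objective MD F \<eta> P E Q h a \<sigma> = (\<lambda>q.
     ereal (q \<bullet> loss_estimate P E h a \<sigma>) + ereal (1 / \<eta>) * bregman F q (Q h))"
| "update_objective FTRL F \<eta> P E Q h a \<sigma> = (\<lambda>q.
     (let h' = h @ [(a, \<sigma>)]
      in ereal (\<Sum>s<length h'. q \<bullet> loss_estimate P E (take s h') (fst (h' ! s)) (snd (h' ! s))))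
     + F q / ereal \<eta>)"

text \<open>The conditions are imposed only on histories that can occur in an \<open>n\<close>-round game. The
  iterate computed after the last round is not required to lie in \<^term>\<open>dom_grad F\<close>.\<close>

definition exploration_by_optimisation ::
    "('d::finite, 'z, 's) pm_game \<Rightarrow> (real ^ 'd \<Rightarrow> ereal) \<Rightarrow> (real ^ 'd) set \<Rightarrow>
     update_rule \<Rightarrow> nat \<Rightarrow> real \<Rightarrow> real \<Rightarrow>
     (('d, 's) history \<Rightarrow> (real ^ 'd) pmf) \<Rightarrow>
     (('d, 's) history \<Rightarrow> real ^ 'd \<Rightarrow> 's \<Rightarrow> real ^ 'd) \<Rightarrow>
     (('d, 's) history \<Rightarrow> real ^ 'd) \<Rightarrow> bool" where
  "exploration_by_optimisation \<G> F D u n \<eta> \<epsilon> P E Q \<longleftrightarrow>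
     is_arg_min F (\<lambda>q. q \<in> D) (Q []) \<and>
     (\<forall>h\<in>histories \<G>. length h < n \<longrightarrow>
        Q h \<in> D \<inter> dom_grad F \<and>
        set_pmf (P h) = actions \<G> \<and>
        Lambda_sup \<G> F D (Q h) \<eta> (P h) (E h) \<le> Lambda_star \<G> F D \<eta> + ereal \<epsilon> \<and>
        (\<forall>a\<in>actions \<G>. \<forall>z\<in>latent \<G>.
           is_arg_min (update_objective u F \<eta> P E Q h a (signal \<G> a z)) (\<lambda>q. q \<in> D)
             (Q (h @ [(a, signal \<G> a z)]))))"

end

theory Submission
  imports Defs
begin

text \<open>Up to the approximation error \<open>domain_gap\<close>, the comparator may be taken in \<open>D\<close>. Both updates then
  satisfy a pathwise bound: the estimated regret minus the stability terms
  \<open>\<Psi>\<^bsub>Q\<^sub>t\<^esub>(\<eta> \<ell>\<^sub>t) / \<eta>\<close> is at most \<open>diam / \<eta>\<close>, where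
  \<open>\<ell>\<^sub>t\<close> is the loss estimate. Taking expectations, each round costs at most \<open>\<Lambda>\<^sup>\<star> + \<epsilon>\<close>.

  To bound \<open>\<Lambda>\<^sup>\<star>\<close>, a minimax theorem exchanges the infimum over \<open>(p, g)\<close> with the supremum over targets.
  Against a fixed prior \<open>\<nu>\<close> the estimator dual to the posterior mean \<open>X\<close> turns the last two terms
  of the objective into \<open>- E D(X, q) / \<eta>\<close>, which is at most \<open>- E D(X, E X) / \<eta>\<close>; the information ratio and
  Young's inequality then bound the value by \<open>\<alpha> + (1 - 1/\<lambda>) \<beta> r\<^sup>1\<^sup>/\<^sup>\<lambda>\<close> with \<open>r = diam / (\<beta> n)\<close>.\<close>

section \<open>Legendre functions\<close>

text \<open>Write H for the conjugate of F. The estimator against a prior comes from minimising the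
  averaged objective: with g(a, \<sigma>) = (p(a) / \<eta>) (grad F q - y), the terms in g become
  (p(a) / \<eta>) (H(y) - <b, y>) plus a part free of y. Averaging replaces b by the posterior mean
  X, and y = grad F X is then optimal. Three obstacles shape the minimax step: X may lie on the
  boundary of the domain of F, where there is no gradient; the set of all estimators is not compact;
  and H may be infinite or discontinuous. The exchange is therefore made on compact approximations
  and up to an arbitrary slack, which is harmless because \<open>Lambda_star\<close> is built from
  an infimum. The learning rate is forced by Young's inequality: it must produce the information
  gain with the coefficient 1/\<eta> that the estimator provides with a negative sign, so that the
  two cancel. Over n rounds \<open>Lambda_star\<close> then contributes a fraction 1 - 1/\<lambda>
  of the final rate, and diam/\<eta> the fraction 1/\<lambda>.\<close>

abbreviation (input) rval :: "('v \<Rightarrow> ereal) \<Rightarrow> 'v \<Rightarrow> real" where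
  "rval F x \<equiv> real_of_ereal (F x)"

lemma GDERIV_unique:
  assumes "GDERIV f x :> a" "GDERIV f x :> b"
  shows "a = b"
proof -
  have "(\<lambda>h. h \<bullet> a) = (\<lambda>h. h \<bullet> b)"
    using assms unfolding gderiv_def by (rule has_derivative_unique)
  then have "\<forall>h. h \<bullet> a = h \<bullet> b" by (simp add: fun_eq_iff)
  then show ?thesis by (simp add: vector_eq_ldot)
qed

lemma grad_eqI: "has_gradient F x v \<Longrightarrow> grad F x = v"
  unfolding grad_def by (rule the_equality) (auto simp: has_gradient_def intro: GDERIV_unique)

lemma has_gradient_grad: "x \<in> dom_grad F \<Longrightarrow> has_gradient F x (grad F x)"
  unfolding dom_grad_def by (auto simp: grad_eqI)

lemma edom_ereal:
  assumes "proper_fun F" "x \<in> edom F"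
  shows "F x = ereal (rval F x)"
  using assms unfolding proper_fun_def edom_def by (cases "F x") auto

lemma convex_fun_edom:
  assumes "proper_fun F" "convex_fun F"
  shows "convex (edom F)"
proof (rule convexI)
  fix x y u v assume xy: "x \<in> edom F" "y \<in> edom F" and uv: "0 \<le> u" "0 \<le> v" "u + v = (1::real)"
  have "F (u *\<^sub>R x + v *\<^sub>R y) \<le> ereal u * F x + ereal v * F y"
    using assms(2) uv unfolding convex_fun_def by blast
  also have "\<dots> = ereal (u * rval F x + v * rval F y)"
    by (subst (1 2) edom_ereal[OF assms(1)]) (use xy in auto)
  finally show "u *\<^sub>R x + v *\<^sub>R y \<in> edom F" unfolding edom_def by (cases "F (u *\<^sub>R x + v *\<^sub>R y)") auto
qed

lemma convex_fun_real:
  assumes "proper_fun F" "convex_fun F"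
  shows "convex_on (edom F) (rval F)"
  unfolding convex_on_def
proof (intro conjI ballI allI impI)
  fix x y u v assume xy: "x \<in> edom F" "y \<in> edom F" and uv: "0 \<le> u" "0 \<le> v" "u + v = (1::real)"
  have e: "F (u *\<^sub>R x + v *\<^sub>R y) = ereal (rval F (u *\<^sub>R x + v *\<^sub>R y))"
    using convexD[OF convex_fun_edom[OF assms] xy uv] by (rule edom_ereal[OF assms(1)])
  have "F (u *\<^sub>R x + v *\<^sub>R y) \<le> ereal u * F x + ereal v * F y"
    using assms(2) uv unfolding convex_fun_def by blast
  also have "\<dots> = ereal (u * rval F x + v * rval F y)"
    by (subst (1 2) edom_ereal[OF assms(1)]) (use xy in auto)
  finally show "rval F (u *\<^sub>R x + v *\<^sub>R y) \<le> u * rval F x + v * rval F y"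
    using e by (metis ereal_less_eq(3))
qed (rule convex_fun_edom[OF assms])

lemma dom_grad_subset_interior: "dom_grad F \<subseteq> interior (edom F)"
proof
  fix x assume "x \<in> dom_grad F"
  then have "\<forall>\<^sub>F y in nhds x. \<bar>F y\<bar> \<noteq> \<infinity>"
    unfolding dom_grad_def has_gradient_def by auto
  then obtain S where "open S" "x \<in> S" "\<forall>y\<in>S. \<bar>F y\<bar> \<noteq> \<infinity>"
    unfolding eventually_nhds by auto
  then have "S \<subseteq> edom F" unfolding edom_def by auto
  with \<open>open S\<close> \<open>x \<in> S\<close> show "x \<in> interior (edom F)" by (rule_tac interiorI)
qed

lemma dom_grad_edom: "x \<in> dom_grad F \<Longrightarrow> x \<in> edom F"
  using dom_grad_subset_interior interior_subset by blast

lemma GDERIV_directional: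
  assumes "GDERIV f x :> g"
  shows "((\<lambda>t. f (x + t *\<^sub>R d)) has_real_derivative (g \<bullet> d)) (at 0)"
proof -
  have "(f has_derivative (\<lambda>h. h \<bullet> g)) (at (x + 0 *\<^sub>R d))" using assms by (simp add: gderiv_def)
  moreover have "((\<lambda>t. x + t *\<^sub>R d) has_derivative (\<lambda>t. t *\<^sub>R d)) (at 0)"
    by (auto intro!: derivative_eq_intros)
  ultimately have "((\<lambda>t. f (x + t *\<^sub>R d)) has_derivative (\<lambda>t. (t *\<^sub>R d) \<bullet> g)) (at 0)"
    using has_derivative_compose[of "\<lambda>t. x + t *\<^sub>R d" "\<lambda>t. t *\<^sub>R d" 0 UNIV f "\<lambda>h. h \<bullet> g"] by simp
  moreover have "(\<lambda>t. (t *\<^sub>R d) \<bullet> g) = (*) (g \<bullet> d)"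
    by (auto simp: fun_eq_iff inner_commute)
  ultimately show ?thesis unfolding has_field_derivative_def by simp
qed

text \<open>The two-sided derivative is also the right-hand limit of the difference quotients.
  Values to the right of 0 are all that convexity provides along a segment, both for the gradient
  inequality and for constrained minimisers.\<close>

lemma derivative_ge_of_right:
  fixes \<phi> :: "real \<Rightarrow> real"
  assumes "(\<phi> has_real_derivative c) (at 0)"
    and "\<And>t. 0 < t \<Longrightarrow> t < 1 \<Longrightarrow> \<phi> t - \<phi> 0 \<ge> t * k"
  shows "c \<ge> k"
proof -
  have "((\<lambda>t. (\<phi> (0 + t) - \<phi> 0) / t) \<longlongrightarrow> c) (at 0)"
    using assms(1) unfolding DERIV_def .
  then have "((\<lambda>t. (\<phi> t - \<phi> 0) / t) \<longlongrightarrow> c) (at_right 0)"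
    by (simp add: filterlim_at_split)
  moreover have "\<forall>\<^sub>F t in at_right 0. k \<le> (\<phi> t - \<phi> 0) / t"
    using assms(2) by (auto simp: eventually_at_right_field field_simps intro!: exI[of _ 1])
  ultimately show ?thesis by (rule tendsto_lowerbound) simp
qed

section \<open>First-order properties of a Legendre function\<close>

context
  fixes F :: "'v::euclidean_space \<Rightarrow> ereal"
  assumes F: "legendre F"
begin

lemma legendre_proper: "proper_fun F" and legendre_convex: "convex_fun F"
  using F unfolding legendre_def by auto

lemma legendre_edom_ereal: "x \<in> edom F \<Longrightarrow> F x = ereal (rval F x)"
  by (rule edom_ereal[OF legendre_proper])

lemma legendre_edomE:
  assumes "x \<in> edom F"
  obtains r where "F x = ereal r"
  using legendre_edom_ereal[OF assms] by blast

lemma interior_edom_eq_dom_grad: "interior (edom F) = dom_grad F"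
  using F dom_grad_subset_interior unfolding legendre_def essentially_smooth_def by auto

lemma open_dom_grad: "open (dom_grad F)"
  using open_interior[of "edom F"] by (simp add: interior_edom_eq_dom_grad)

lemma convex_on_dom_grad: "convex_on (dom_grad F) (rval F)"
proof (rule convex_on_subset[OF convex_fun_real[OF legendre_proper legendre_convex]])
  show "dom_grad F \<subseteq> edom F" using dom_grad_edom by blast
  show "convex (dom_grad F)"
    using convex_interior[OF convex_fun_edom[OF legendre_proper legendre_convex]]
    by (simp add: interior_edom_eq_dom_grad)
qed

lemma continuous_on_dom_grad: "continuous_on (dom_grad F) (rval F)"
  by (rule convex_on_continuous[OF open_dom_grad convex_on_dom_grad])

lemma grad_inequality:
  assumes x: "x \<in> dom_grad F" and y: "y \<in> edom F"
  shows "rval F x + grad F x \<bullet> (y - x) \<le> rval F y"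
proof -
  have g: "GDERIV (rval F) x :> grad F x"
    using has_gradient_grad[OF x] unfolding has_gradient_def by simp
  \<comment> \<open>Convexity bounds the increments of F from above, so the lower-bound lemma is
    applied to the negative of F.\<close>
  have "((\<lambda>t. - rval F (x + t *\<^sub>R (y - x))) has_real_derivative - (grad F x \<bullet> (y - x))) (at 0)"
    by (rule DERIV_minus[OF GDERIV_directional[OF g]])
  moreover have "- rval F (x + t *\<^sub>R (y - x)) - - rval F (x + 0 *\<^sub>R (y - x)) \<ge> t * (- (rval F y - rval F x))"
    if "0 < t" "t < 1" for t
  proof -
    have "x + t *\<^sub>R (y - x) = (1 - t) *\<^sub>R x + t *\<^sub>R y" by (simp add: algebra_simps)
    then have "rval F (x + t *\<^sub>R (y - x)) \<le> (1 - t) * rval F x + t * rval F y"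
      using convex_onD[OF convex_fun_real[OF legendre_proper legendre_convex], of t x y] that
        dom_grad_edom[OF x] y by simp
    then show ?thesis by (simp add: algebra_simps)
  qed
  ultimately have "- (grad F x \<bullet> (y - x)) \<ge> - (rval F y - rval F x)"
    by (rule derivative_ge_of_right)
  then show ?thesis by simp
qed

text \<open>At a constrained minimiser the derivative of the objective towards \<open>b\<close> is
  nonnegative. Adding the Bregman divergence then cancels the gradient term and improves plain
  minimality by exactly that divergence.\<close>

lemma first_order_optimality:
  assumes D: "convex D" "D \<subseteq> edom F" and q: "q \<in> D" "q \<in> dom_grad F"
    and min: "\<And>x. x \<in> D \<Longrightarrow> q \<bullet> v + rval F q \<le> x \<bullet> v + rval F x" and b: "b \<in> D"
  shows "q \<bullet> v + rval F q + (rval F b - rval F q - grad F q \<bullet> (b - q)) \<le> b \<bullet> v + rval F b"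
proof -
  have g: "GDERIV (rval F) q :> grad F q"
    using has_gradient_grad[OF q(2)] unfolding has_gradient_def by simp
  have "((\<lambda>t. (q + t *\<^sub>R (b - q)) \<bullet> v + rval F (q + t *\<^sub>R (b - q)))
      has_real_derivative ((b - q) \<bullet> v + grad F q \<bullet> (b - q))) (at 0)"
    by (intro DERIV_add GDERIV_directional[OF g]) (auto intro!: derivative_eq_intros simp: inner_add_left)
  moreover have "(q + t *\<^sub>R (b - q)) \<bullet> v + rval F (q + t *\<^sub>R (b - q)) -
      ((q + 0 *\<^sub>R (b - q)) \<bullet> v + rval F (q + 0 *\<^sub>R (b - q))) \<ge> t * 0" if "0 < t" "t < 1" for t
  proof -
    have "q + t *\<^sub>R (b - q) = (1 - t) *\<^sub>R q + t *\<^sub>R b" by (simp add: algebra_simps)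
    then have "q + t *\<^sub>R (b - q) \<in> D"
      using convexD[OF D(1) q(1) b, of "1 - t" t] that by simp
    from min[OF this] show ?thesis by simp
  qed
  ultimately have "(b - q) \<bullet> v + grad F q \<bullet> (b - q) \<ge> 0"
    by (rule derivative_ge_of_right)
  then show ?thesis by (simp add: inner_diff_left)
qed

lemma bregman_real:
  assumes "p \<in> edom F" "q \<in> dom_grad F"
  shows "bregman F p q = ereal (rval F p - rval F q - grad F q \<bullet> (p - q))"
proof -
  obtain r s where "F p = ereal r" "F q = ereal s"
    using legendre_edomE[OF assms(1)] legendre_edomE[OF dom_grad_edom[OF assms(2)]] by metis
  then show ?thesis unfolding bregman_def grad_pairing_def using assms(2) by simp
qed

section \<open>The Fenchel conjugate and its gradient\<close>

lemma fenchel_young: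
  assumes "x \<in> edom F"
  shows "ereal (y \<bullet> x - rval F x) \<le> fenchel_conj F y"
proof -
  obtain r where "F x = ereal r" using assms by (rule legendre_edomE)
  then show ?thesis unfolding fenchel_conj_def by (intro SUP_upper2[of x]) auto
qed

text \<open>Points outside the domain contribute -\<infinity> to the supremum. This reduces bounds
  on the conjugate to real inequalities, in the form used by \<open>dual_epigraph\<close>.\<close>

lemma fenchel_conj_le_iff:
  "fenchel_conj F y \<le> ereal c \<longleftrightarrow> (\<forall>x\<in>edom F. y \<bullet> x - rval F x \<le> c)"
proof
  assume "fenchel_conj F y \<le> ereal c"
  then show "\<forall>x\<in>edom F. y \<bullet> x - rval F x \<le> c"
    using fenchel_young[of _ y] by (meson ereal_less_eq(3) order_trans)
next
  assume *: "\<forall>x\<in>edom F. y \<bullet> x - rval F x \<le> c"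
  show "fenchel_conj F y \<le> ereal c"
    unfolding fenchel_conj_def
  proof (rule SUP_least)
    fix x
    show "ereal (y \<bullet> x) - F x \<le> ereal c"
    proof (cases "x \<in> edom F")
      case True
      then obtain r where "F x = ereal r" by (rule legendre_edomE)
      then show ?thesis using * True by force
    next
      case False
      then have "F x = \<infinity>" unfolding edom_def by auto
      then show ?thesis by simp
    qed
  qed
qed

lemma fenchel_conj_grad:
  assumes "x \<in> dom_grad F"
  shows "fenchel_conj F (grad F x) = ereal (grad F x \<bullet> x - rval F x)"
proof (rule antisym)
  show "fenchel_conj F (grad F x) \<le> ereal (grad F x \<bullet> x - rval F x)"
    unfolding fenchel_conj_le_iff using grad_inequality[OF assms] by (fastforce simp: inner_diff_right)
qed (rule fenchel_young[OF dom_grad_edom[OF assms]])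

text \<open>The gradients are subgradients, so the interior of the domain is a convex set on which
  essential strict convexity applies. The value at the midpoint is then strictly below the average,
  while the gradient inequality bounds it from below; comparing the two gives strictness.\<close>

lemma grad_inequality_strict:
  assumes x: "x \<in> dom_grad F" and y: "y \<in> dom_grad F" and "x \<noteq> y"
  shows "rval F x + grad F x \<bullet> (y - x) < rval F y"
proof -
  have sub: "subdifferential F w \<noteq> {}" if w: "w \<in> interior (edom F)" for w
  proof -
    have w': "w \<in> dom_grad F" using w interior_edom_eq_dom_grad by simp
    have "F w + ereal (grad F w \<bullet> (v - w)) \<le> F v" for v
    proof (cases "v \<in> edom F")
      case True
      obtain r s where "F v = ereal r" "F w = ereal s"
        using legendre_edomE[OF True] legendre_edomE[OF dom_grad_edom[OF w']] by metis
      then show ?thesis using grad_inequality[OF w' True] by simp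
    next
      case False
      then have "F v = \<infinity>" unfolding edom_def by auto
      then show ?thesis by simp
    qed
    then show ?thesis unfolding subdifferential_def by blast
  qed
  have "convex (interior (edom F))"
    by (intro convex_interior convex_fun_edom legendre_proper legendre_convex)
  then have "strictly_convex_fun_on (interior (edom F)) F"
    using F sub unfolding legendre_def essentially_strictly_convex_def by blast
  then have lt: "F ((1/2) *\<^sub>R x + (1/2) *\<^sub>R y) < ereal (1/2) * F x + ereal (1/2) * F y"
    using assms interior_edom_eq_dom_grad unfolding strictly_convex_fun_on_def
    by (metis divide_pos_pos field_sum_of_halves zero_less_numeral zero_less_one)
  let ?m = "(1/2) *\<^sub>R x + (1/2) *\<^sub>R y"
  have m: "?m \<in> edom F"
    using convexD[OF convex_fun_edom[OF legendre_proper legendre_convex] dom_grad_edom[OF x] dom_grad_edom[OF y], of "1/2" "1/2"]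
    by simp
  have "rval F ?m < (1/2) * rval F x + (1/2) * rval F y"
  proof -
    obtain r s t where "F ?m = ereal r" "F x = ereal s" "F y = ereal t"
      using legendre_edomE[OF m] legendre_edomE[OF dom_grad_edom[OF x]]
        legendre_edomE[OF dom_grad_edom[OF y]] by metis
    with lt show ?thesis by simp
  qed
  moreover have "rval F x + grad F x \<bullet> (?m - x) \<le> rval F ?m" by (rule grad_inequality[OF x m])
  moreover have "?m - x = (1/2) *\<^sub>R (y - x)" by (simp add: algebra_simps flip: scaleR_left.add)
  ultimately show ?thesis by simp
qed

text \<open>Strict convexity on a sphere around \<open>q\<close> propagates outwards along rays, which makes the
  conjugate finite near \<open>grad F q\<close> and controls it there.\<close>

lemma fenchel_conj_near_grad:
  assumes q: "q \<in> dom_grad F" and "0 < e"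
  obtains r where "0 < r" and
    "\<And>v. norm v < r \<Longrightarrow> fenchel_conj F (grad F q + v) \<le> ereal (grad F q \<bullet> q - rval F q + q \<bullet> v + e * norm v)"
proof -
  obtain s0 where s0: "s0 > 0" "cball q s0 \<subseteq> dom_grad F"
    using q open_dom_grad open_contains_cball by blast
  \<comment> \<open>The bound \<open>s \<le> e\<close> serves the near region: for
    \<open>norm (x - q) \<le> s\<close> the inner product of \<open>v\<close> and
    \<open>x - q\<close> is at most \<open>e * norm v\<close>.\<close>
  define s where "s = min s0 e"
  have s: "s > 0" "s \<le> e" and sub: "sphere q s \<subseteq> dom_grad F"
    using s0 \<open>0 < e\<close> unfolding s_def by auto
  define g where "g y = rval F y - rval F q - grad F q \<bullet> (y - q)" for y
  have "continuous_on (sphere q s) g"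
    unfolding g_def by (intro continuous_intros) (rule continuous_on_subset[OF continuous_on_dom_grad sub])
  moreover have "sphere q s \<noteq> {}" using s by simp
  ultimately obtain y0 where y0: "y0 \<in> sphere q s" "\<And>y. y \<in> sphere q s \<Longrightarrow> g y0 \<le> g y"
    using continuous_attains_inf[OF compact_sphere] by metis
  define c where "c = g y0"
  have c: "c > 0"
    using grad_inequality_strict[OF q, of y0] y0(1) sub s unfolding c_def g_def by force
  \<comment> \<open>The Bregman divergence \<open>g\<close> vanishes at \<open>q\<close> and is at
    least \<open>c\<close> where the segment from \<open>q\<close> to \<open>y\<close> crosses the
    sphere; convexity along that segment makes it grow at least linearly beyond.\<close>
  have far: "g y \<ge> c / s * norm (y - q)" if y: "y \<in> edom F" and far: "norm (y - q) > s" for y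
  proof -
    define t where "t = s / norm (y - q)"
    have t: "0 < t" "t < 1" using far s unfolding t_def by (auto simp: divide_simps)
    have n: "norm (y - q) > 0" using far s by linarith
    have "dist q (q + t *\<^sub>R (y - q)) = s" unfolding t_def using n s by (simp add: dist_norm)
    then have "c \<le> g (q + t *\<^sub>R (y - q))" using y0(2)[of "q + t *\<^sub>R (y - q)"] unfolding c_def by simp
    also have "q + t *\<^sub>R (y - q) = (1 - t) *\<^sub>R q + t *\<^sub>R y" by (simp add: algebra_simps)
    also have "g \<dots> \<le> t * g y"
      using convex_onD[OF convex_fun_real[OF legendre_proper legendre_convex], of t q y] t y dom_grad_edom[OF q]
      unfolding g_def by (simp add: algebra_simps inner_add_right inner_diff_right)
    finally show ?thesis unfolding t_def using n s by (simp add: field_simps)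
  qed
  show ?thesis
  \<comment> \<open>A perturbation \<open>v\<close> of norm below the growth rate
    \<open>c / s\<close> cannot outweigh \<open>g\<close> outside the ball.\<close>
  proof (rule that[of "c / s"])
    fix v :: 'v assume v: "norm v < c / s"
    show "fenchel_conj F (grad F q + v) \<le> ereal (grad F q \<bullet> q - rval F q + q \<bullet> v + e * norm v)"
      unfolding fenchel_conj_le_iff
    proof
      fix x assume x: "x \<in> edom F"
      have cs: "v \<bullet> (x - q) \<le> norm v * norm (x - q)" by (rule norm_cauchy_schwarz)
      have "v \<bullet> (x - q) - g x \<le> e * norm v"
      proof (cases "norm (x - q) > s")
        case True
        have "norm v * norm (x - q) \<le> c / s * norm (x - q)"
          using v by (intro mult_right_mono) auto
        then show ?thesis using far[OF x True] cs \<open>0 < e\<close> by (smt (verit) mult_nonneg_nonneg norm_ge_zero)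
      next
        case False
        have "norm v * norm (x - q) \<le> norm v * e"
          using False s by (intro mult_left_mono) auto
        moreover have "g x \<ge> 0" using grad_inequality[OF q x] unfolding g_def by simp
        ultimately show ?thesis using cs by (simp add: mult.commute)
      qed
      then show "(grad F q + v) \<bullet> x - rval F x \<le> grad F q \<bullet> q - rval F q + q \<bullet> v + e * norm v"
        unfolding g_def by (simp add: algebra_simps inner_add_left inner_diff_right inner_commute)
    qed
  qed (use c s in simp)
qed

text \<open>The gradient of the conjugate inverts the gradient of F. The conjugate is squeezed near
  \<open>grad F q\<close>: Fenchel-Young at \<open>q\<close> gives an affine lower bound with slope
  \<open>q\<close>, and the preceding lemma an upper bound that exceeds it by at most
  \<open>e * norm v\<close>.\<close>

lemma has_gradient_fenchel_conj:
  assumes q: "q \<in> dom_grad F"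
  shows "has_gradient (fenchel_conj F) (grad F q) q"
proof -
  let ?H = "rval (fenchel_conj F)" and ?u = "grad F q"
  have low: "ereal (?u \<bullet> q - rval F q + q \<bullet> v) \<le> fenchel_conj F (?u + v)" for v
    using fenchel_young[OF dom_grad_edom[OF q], of "?u + v"]
    by (simp add: inner_add_left inner_commute algebra_simps)
  have near: "\<exists>r>0. \<forall>v. norm v < r \<longrightarrow> \<bar>fenchel_conj F (?u + v)\<bar> \<noteq> \<infinity> \<and>
      \<bar>?H (?u + v) - ?H ?u - v \<bullet> q\<bar> \<le> e * norm v" if e: "e > 0" for e
  proof -
    obtain r where r: "r > 0" "\<And>v. norm v < r \<Longrightarrow>
        fenchel_conj F (?u + v) \<le> ereal (?u \<bullet> q - rval F q + q \<bullet> v + e * norm v)"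
      by (rule fenchel_conj_near_grad[OF q e]) blast
    have "\<bar>fenchel_conj F (?u + v)\<bar> \<noteq> \<infinity> \<and> \<bar>?H (?u + v) - ?H ?u - v \<bullet> q\<bar> \<le> e * norm v"
      if "norm v < r" for v
      using r(2)[OF that] low[of v] fenchel_conj_grad[OF q] e
      by (cases "fenchel_conj F (?u + v)") (auto simp: inner_commute)
    with r show ?thesis by blast
  qed
  have "\<forall>\<^sub>F y in nhds ?u. \<bar>fenchel_conj F y\<bar> \<noteq> \<infinity>"
  proof -
    obtain r where r: "r > 0" "\<And>v. norm v < r \<Longrightarrow> \<bar>fenchel_conj F (?u + v)\<bar> \<noteq> \<infinity>"
      using near[of 1] by auto
    show ?thesis unfolding eventually_nhds_metric
    proof (intro exI[of _ r] conjI allI impI r(1))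
      fix y assume "dist y ?u < r"
      then show "\<bar>fenchel_conj F y\<bar> \<noteq> \<infinity>" using r(2)[of "y - ?u"] by (simp add: dist_norm)
    qed
  qed
  moreover have "GDERIV ?H ?u :> q"
    unfolding gderiv_def has_derivative_at_alt
  proof (intro conjI allI impI)
    show "bounded_linear (\<lambda>h. h \<bullet> q)" by (rule bounded_linear_inner_left)
    fix e :: real assume "e > 0"
    then obtain r where r: "r > 0" "\<And>v. norm v < r \<Longrightarrow> \<bar>?H (?u + v) - ?H ?u - v \<bullet> q\<bar> \<le> e * norm v"
      using near by meson
    have "norm (?H y - ?H ?u - (y - ?u) \<bullet> q) \<le> e * norm (y - ?u)" if "norm (y - ?u) < r" for y
      using r(2)[OF that] by simp
    with r show "\<exists>d>0. \<forall>y. norm (y - ?u) < d \<longrightarrow> norm (?H y - ?H ?u - (y - ?u) \<bullet> q) \<le> e * norm (y - ?u)"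
      by blast
  qed
  ultimately show ?thesis unfolding has_gradient_def by simp
qed

text \<open>The conjugate and its gradient at \<open>grad F q\<close> are known and finite, so the
  only term that may be infinite is the conjugate at the shifted point.\<close>

lemma Psi_eq:
  assumes q: "q \<in> dom_grad F"
  shows "Psi F q x = fenchel_conj F (grad F q - x) + ereal (rval F q - grad F q \<bullet> q + q \<bullet> x)"
proof -
  have "Psi F q x = fenchel_conj F (grad F q - x) - ereal (grad F q \<bullet> q - rval F q) - ereal (q \<bullet> (- x))"
    unfolding Psi_def bregman_dual_def fenchel_conj_grad[OF q] grad_eqI[OF has_gradient_fenchel_conj[OF q]]
    by simp
  then show ?thesis by (cases "fenchel_conj F (grad F q - x)") auto
qed

text \<open>This is Fenchel-Young at the shifted dual point, tested with \<open>r\<close>. In the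
  regret analysis it trades the movement from \<open>q\<close> to \<open>r\<close> against the
  divergence of \<open>r\<close> from \<open>q\<close>.\<close>

lemma Psi_lower_bound:
  assumes q: "q \<in> dom_grad F" and r: "r \<in> edom F"
  shows "ereal ((q - r) \<bullet> x - (rval F r - rval F q - grad F q \<bullet> (r - q))) \<le> Psi F q x"
proof -
  have "ereal ((q - r) \<bullet> x - (rval F r - rval F q - grad F q \<bullet> (r - q))) =
      ereal ((grad F q - x) \<bullet> r - rval F r) + ereal (rval F q - grad F q \<bullet> q + q \<bullet> x)"
    by (simp add: inner_diff_left inner_diff_right inner_commute)
  also have "\<dots> \<le> Psi F q x"
    unfolding Psi_eq[OF q] by (intro add_right_mono fenchel_young[OF r])
  finally show ?thesis .
qed

lemma Psi_nonneg: "q \<in> dom_grad F \<Longrightarrow> 0 \<le> Psi F q x"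
  using Psi_lower_bound[of q q x] dom_grad_edom[of q F] by (simp add: zero_ereal_def)

text \<open>A slightly fattened compact set still lies in the open set \<open>dom_grad F\<close>, so
  F is bounded by some \<open>M\<close> there. A step of length \<open>r\<close> in the direction of
  the gradient raises F by at least \<open>r\<close> times the norm of the gradient, hence that norm
  is at most \<open>2 * M / r\<close>.\<close>

lemma bounded_grad_on_compact:
  assumes S: "compact S" "S \<subseteq> dom_grad F"
  obtains R where "R \<ge> 0" "\<And>x. x \<in> S \<Longrightarrow> norm (grad F x) \<le> R" "\<And>x. x \<in> S \<Longrightarrow> \<bar>rval F x\<bar> \<le> R"
proof (cases "S = {}")
  case False
  obtain r where r: "r > 0" "(\<Union>x\<in>S. cball x r) \<subseteq> dom_grad F"
    using compact_subset_open_imp_cball_epsilon_subset[OF S(1) open_dom_grad S(2)] by metis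
  define T where "T = (\<Union>x\<in>S. cball x r)"
  have "compact T" unfolding T_def by (rule compact_minkowski_sum_cball[OF S(1)])
  then have "bounded (rval F ` T)"
    using r(2) continuous_on_dom_grad unfolding T_def
    by (intro compact_imp_bounded compact_continuous_image) (auto intro: continuous_on_subset)
  then obtain M where M: "\<And>x. x \<in> T \<Longrightarrow> \<bar>rval F x\<bar> \<le> M"
    unfolding bounded_iff by auto
  have ST: "S \<subseteq> T" unfolding T_def using r(1) by auto
  have M0: "M \<ge> 0" using M ST False by (meson abs_ge_zero all_not_in_conv order_trans subsetD)
  show ?thesis
  proof (rule that[of "max M (2 * M / r)"])
    fix x assume x: "x \<in> S"
    show "norm (grad F x) \<le> max M (2 * M / r)"
    proof (cases "grad F x = 0")
      case False
      define y where "y = x + (r / norm (grad F x)) *\<^sub>R grad F x"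
      have "y \<in> T" unfolding T_def y_def using x r(1) False by (auto simp: dist_norm intro!: bexI[of _ x])
      then have "rval F x + grad F x \<bullet> (y - x) \<le> rval F y"
        using grad_inequality[of x y] x S(2) r(2) dom_grad_edom unfolding T_def by blast
      moreover have "grad F x \<bullet> (y - x) = r * norm (grad F x)"
        unfolding y_def using False by (simp add: power2_eq_square flip: power2_norm_eq_inner)
      ultimately have "r * norm (grad F x) \<le> 2 * M" using M[OF \<open>y \<in> T\<close>] M[OF subsetD[OF ST x]] by linarith
      then show ?thesis using r(1) by (simp add: field_simps le_max_iff_disj)
    qed (use M0 in simp)
  qed (use M ST M0 in \<open>force+\<close>)
qed (use that[of 0] in auto)

end

section \<open>A minimax theorem\<close>

text \<open>Ky Fan's notion: \<open>X\<close> needs no linear structure, but one point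
  \<open>w\<close> must serve all indices at once. Strategies are mixed by weighting with action
  probabilities rather than coordinatewise, which is why ordinary convexity is not the right
  requirement.\<close>

definition convexlike :: "'x set \<Rightarrow> 'i set \<Rightarrow> ('i \<Rightarrow> 'x \<Rightarrow> real) \<Rightarrow> bool" where
  "convexlike X I f \<longleftrightarrow>
     (\<forall>x\<in>X. \<forall>y\<in>X. \<forall>t\<in>{0..1}. \<exists>w\<in>X. \<forall>i\<in>I. f i w \<le> (1 - t) * f i x + t * f i y)"

text \<open>Separation in the plane. The upward closure \<open>S\<close> of the image of (f, g) is
  convex and misses the open quadrant \<open>T\<close> below (c, c); the normal of a separating
  line, normalised to sum 1, supplies the weights.\<close>

lemma convexlike_two:
  fixes f g :: "'x \<Rightarrow> real"
  assumes cl: "\<And>x y t. x \<in> X \<Longrightarrow> y \<in> X \<Longrightarrow> t \<in> {0..1} \<Longrightarrow>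
      \<exists>w\<in>X. f w \<le> (1 - t) * f x + t * f y \<and> g w \<le> (1 - t) * g x + t * g y"
    and pos: "\<And>x. x \<in> X \<Longrightarrow> c \<le> f x \<or> c \<le> g x"
  shows "\<exists>t\<in>{0..1}. \<forall>x\<in>X. c \<le> (1 - t) * f x + t * g x"
proof (cases "X = {}")
  case False
  then obtain x0 where x0: "x0 \<in> X" by blast
  define S where "S = {(a, b). \<exists>x\<in>X. f x \<le> a \<and> g x \<le> b}"
  define T where "T = {..<c} \<times> {..<c}"
  have "convex S"
  proof (rule convexI)
    fix p q u v assume "p \<in> S" "q \<in> S" and uv: "0 \<le> u" "0 \<le> v" "u + v = (1::real)"
    then obtain a b x a' b' y where pq: "p = (a, b)" "x \<in> X" "f x \<le> a" "g x \<le> b"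
      "q = (a', b')" "y \<in> X" "f y \<le> a'" "g y \<le> b'"
      unfolding S_def by auto
    obtain w where w: "w \<in> X" "f w \<le> (1 - v) * f x + v * f y" "g w \<le> (1 - v) * g x + v * g y"
      using cl[OF pq(2) pq(6), of v] uv by auto
    have u: "1 - v = u" using uv by simp
    have "u * f x + v * f y \<le> u * a + v * a'" "u * g x + v * g y \<le> u * b + v * b'"
      using uv pq by (intro add_mono mult_left_mono; simp)+
    then show "u *\<^sub>R p + v *\<^sub>R q \<in> S"
      using w pq unfolding u S_def by (auto intro!: bexI[of _ w])
  qed
  moreover have "convex T" unfolding T_def by (intro convex_Times convex_real_interval)
  moreover have "(f x0, g x0) \<in> S" unfolding S_def using x0 by auto
  moreover have "(c - 1, c - 1) \<in> T" unfolding T_def by simp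
  moreover have "T \<inter> S = {}" unfolding S_def T_def using pos by force
  ultimately obtain k d where k: "k \<noteq> 0" "\<forall>v\<in>T. k \<bullet> v \<le> d" "\<forall>v\<in>S. d \<le> k \<bullet> v"
    using separating_hyperplane_sets[of T S] by blast
  obtain k1 k2 where kk: "k = (k1, k2)" by force
  have S: "d \<le> k1 * a + k2 * b" if "x \<in> X" "f x \<le> a" "g x \<le> b" for x a b
    using k(3) that unfolding S_def kk by auto
  have T: "k1 * a + k2 * b \<le> d" if "a < c" "b < c" for a b
    using k(2) that unfolding T_def kk by auto
  \<comment> \<open>Since \<open>S\<close> is closed upwards, a negative coordinate of the normal
    would make the linear functional unbounded below on \<open>S\<close>.\<close>
  have nonneg: "0 \<le> r" if "\<And>s. 0 \<le> s \<Longrightarrow> d \<le> h + r * s" for r h :: real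
  proof (rule ccontr)
    assume "\<not> 0 \<le> r"
    then have r: "r < 0" by simp
    have "d \<le> h + r * ((\<bar>h - d\<bar> + 1) / (- r))" using r by (intro that) (simp add: divide_nonneg_neg)
    also have "\<dots> = h - (\<bar>h - d\<bar> + 1)" using r by (simp add: field_simps)
    finally show False by linarith
  qed
  have k1: "0 \<le> k1"
    using S[OF x0, of "f x0 + _" "g x0"]
    by (intro nonneg[of "k1 * f x0 + k2 * g x0"]) (simp add: algebra_simps)
  have k2: "0 \<le> k2"
    using S[OF x0, of "f x0" "g x0 + _"]
    by (intro nonneg[of "k1 * f x0 + k2 * g x0"]) (simp add: algebra_simps)
  have kpos: "0 < k1 + k2" using k1 k2 k(1) unfolding kk by (cases "k1 = 0") (auto simp: zero_prod_def)
  \<comment> \<open>The corner (c, c) is not in \<open>T\<close>; it is approached along the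
    diagonal.\<close>
  have d: "(k1 + k2) * c \<le> d"
  proof (rule field_le_epsilon)
    fix e :: real assume "0 < e"
    define x where "x = e / (k1 + k2)"
    have "0 < x" "(k1 + k2) * x = e" unfolding x_def using kpos \<open>0 < e\<close> by auto
    moreover from this have "k1 * (c - x) + k2 * (c - x) \<le> d" by (intro T) auto
    ultimately show "(k1 + k2) * c \<le> d + e" by (simp add: algebra_simps)
  qed
  show ?thesis
  proof (intro bexI[of _ "k2 / (k1 + k2)"] ballI)
    fix x assume "x \<in> X"
    then have "(k1 + k2) * c \<le> k1 * f x + k2 * g x" using d S[of x "f x" "g x"] by simp
    then have "c \<le> (k1 * f x + k2 * g x) / (k1 + k2)"
      using kpos by (simp add: pos_le_divide_eq mult.commute)
    also have "\<dots> = (1 - k2 / (k1 + k2)) * f x + k2 / (k1 + k2) * g x"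
    proof -
      have "1 - k2 / (k1 + k2) = k1 / (k1 + k2)" using kpos by (simp add: diff_divide_eq_iff)
      then show ?thesis by (simp add: add_divide_distrib)
    qed
    finally show "c \<le> (1 - k2 / (k1 + k2)) * f x + k2 / (k1 + k2) * g x" .
  qed (use k1 k2 kpos in auto)
qed (auto intro: bexI[of _ 0])

text \<open>Induction on the index set with \<open>X\<close> generalised: where the new function
  \<open>f j\<close> is below \<open>c\<close>, the old ones must do the work, so the induction
  hypothesis is applied to that subset, which is again convexlike. The resulting average and
  \<open>f j\<close> satisfy the two-function case on all of \<open>X\<close>.\<close>

lemma convexlike_weights:
  assumes "finite I" "I \<noteq> {}" "convexlike X I f" "\<And>x. x \<in> X \<Longrightarrow> \<exists>i\<in>I. c \<le> f i x"
  shows "\<exists>w. (\<forall>i\<in>I. 0 \<le> w i) \<and> sum w I = 1 \<and> (\<forall>x\<in>X. c \<le> (\<Sum>i\<in>I. w i * f i x))"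
  using assms
proof (induction I arbitrary: X rule: finite_ne_induct)
  case (singleton i)
  then show ?case by (intro exI[of _ "\<lambda>_. 1"]) auto
next
  case (insert j I)
  define X' where "X' = {x \<in> X. f j x < c}"
  have "convexlike X' I f" unfolding convexlike_def
  proof (intro ballI)
    fix x y t assume xy: "x \<in> X'" "y \<in> X'" and t: "t \<in> {0..1::real}"
    then obtain w where w: "w \<in> X" "\<forall>i\<in>insert j I. f i w \<le> (1 - t) * f i x + t * f i y"
      using insert.prems(1) unfolding convexlike_def X'_def by blast
    have "f j w \<le> (1 - t) * f j x + t * f j y" using w by simp
    also have "\<dots> < c" using xy t convex_bound_lt[of "f j x" c "f j y" "1 - t" t] unfolding X'_def by simp
    finally show "\<exists>w\<in>X'. \<forall>i\<in>I. f i w \<le> (1 - t) * f i x + t * f i y"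
      using w unfolding X'_def by auto
  qed
  moreover have "\<exists>i\<in>I. c \<le> f i x" if "x \<in> X'" for x
    using insert.prems(2)[of x] that unfolding X'_def by auto
  ultimately obtain w where w: "\<forall>i\<in>I. 0 \<le> w i" "sum w I = 1" "\<forall>x\<in>X'. c \<le> (\<Sum>i\<in>I. w i * f i x)"
    using insert.IH by blast
  define g where "g x = (\<Sum>i\<in>I. w i * f i x)" for x
  have "\<exists>t\<in>{0..1}. \<forall>x\<in>X. c \<le> (1 - t) * g x + t * f j x"
  proof (rule convexlike_two)
    fix x y t assume xy: "x \<in> X" "y \<in> X" and t: "t \<in> {0..1::real}"
    then obtain v where v: "v \<in> X" "\<forall>i\<in>insert j I. f i v \<le> (1 - t) * f i x + t * f i y"
      using insert.prems(1) unfolding convexlike_def by blast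
    have "g v \<le> (\<Sum>i\<in>I. w i * ((1 - t) * f i x + t * f i y))"
      unfolding g_def using v(2) w(1) by (intro sum_mono mult_left_mono) auto
    also have "\<dots> = (1 - t) * g x + t * g y"
      unfolding g_def by (simp add: sum_distrib_left sum.distrib algebra_simps sum_subtractf)
    finally show "\<exists>v\<in>X. g v \<le> (1 - t) * g x + t * g y \<and> f j v \<le> (1 - t) * f j x + t * f j y"
      using v by auto
  next
    fix x assume "x \<in> X"
    then show "c \<le> g x \<or> c \<le> f j x" using w(3) unfolding X'_def g_def by force
  qed
  then obtain t where t: "t \<in> {0..1}" "\<forall>x\<in>X. c \<le> (1 - t) * g x + t * f j x" by blast
  define w' where "w' i = (if i = j then t else (1 - t) * w i)" for i
  have w'I: "w' i = (1 - t) * w i" if "i \<in> I" for i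
    using that insert.hyps unfolding w'_def by auto
  have "sum w' (insert j I) = 1"
    using insert.hyps w(2) by (simp add: w'I flip: sum_distrib_left) (simp add: w'_def)
  moreover have "(\<Sum>i\<in>insert j I. w' i * f i x) = (1 - t) * g x + t * f j x" for x
    using insert.hyps unfolding g_def
    by (simp add: w'I sum_distrib_left mult.assoc) (simp add: w'_def)
  moreover have "\<forall>i\<in>insert j I. 0 \<le> w' i" using t(1) w(1) unfolding w'_def by auto
  ultimately show ?case using t(2) by (intro exI[of _ w']) auto
qed

text \<open>By the finite intersection property it suffices to treat finitely many indices. If their
  sublevel sets at \<open>d\<close> had no common point, the weights of the preceding lemma would
  make an average at least \<open>d\<close> throughout \<open>X\<close>, against \<open>avg\<close>
  and \<open>c < d\<close>.\<close>

lemma minimax_compact: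
  fixes f :: "'i \<Rightarrow> 'x::topological_space \<Rightarrow> real"
  assumes X: "compact X" "X \<noteq> {}"
    and cont: "\<And>i. i \<in> I \<Longrightarrow> continuous_on UNIV (f i)"
    and cl: "convexlike X I f"
    and avg: "\<And>J w. finite J \<Longrightarrow> J \<subseteq> I \<Longrightarrow> \<forall>i\<in>J. 0 \<le> w i \<Longrightarrow> sum w J = 1 \<Longrightarrow>
      \<exists>x\<in>X. (\<Sum>i\<in>J. w i * f i x) \<le> c"
    and "c < d"
  shows "\<exists>x\<in>X. \<forall>i\<in>I. f i x \<le> d"
proof -
  have "X \<inter> (\<Inter>i\<in>I. {x. f i x \<le> d}) \<noteq> {}"
  proof (rule compact_imp_fip_image[OF X(1)])
    fix i assume "i \<in> I"
    then show "closed {x. f i x \<le> d}"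
      using cont by (intro closed_Collect_le) auto
  next
    fix J assume J: "finite J" "J \<subseteq> I"
    show "X \<inter> (\<Inter>i\<in>J. {x. f i x \<le> d}) \<noteq> {}"
    proof (cases "J = {}")
      case False
      show ?thesis
      proof
        assume empty: "X \<inter> (\<Inter>i\<in>J. {x. f i x \<le> d}) = {}"
        have "convexlike X J f" using cl J(2) unfolding convexlike_def by blast
        moreover have "\<exists>i\<in>J. d \<le> f i x" if "x \<in> X" for x
          using empty that by (auto simp: disjoint_iff not_le intro: less_imp_le)
        ultimately obtain w where w: "\<forall>i\<in>J. 0 \<le> w i" "sum w J = 1"
          "\<forall>x\<in>X. d \<le> (\<Sum>i\<in>J. w i * f i x)"
          using convexlike_weights[OF J(1) False] by blast
        then show False using avg[OF J w(1,2)] \<open>c < d\<close> by force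
      qed
    qed (use X in simp)
  qed
  then show ?thesis by auto
qed

text \<open>Tychonoff's theorem, as function types carry the product topology. The index type is
  arbitrary, so infinitely many signals are covered.\<close>

lemma compact_functions:
  fixes K :: "'b::topological_space set"
  assumes "compact K"
  shows "compact {w :: 'k \<Rightarrow> 'b. \<forall>k. w k \<in> K}"
proof -
  have "compactin (product_topology (\<lambda>_::'k. euclidean) UNIV) (PiE UNIV (\<lambda>_. K))"
    using assms by (simp add: compactin_PiE)
  moreover have "PiE UNIV (\<lambda>_::'k. K) = {w. \<forall>k. w k \<in> K}" by auto
  ultimately show ?thesis by (simp add: euclidean_product_topology)
qed

section \<open>Finitely supported distributions\<close>

lemma pmf_of_weights:
  assumes J: "finite J" and w: "\<forall>i\<in>J. 0 \<le> w i" and s: "sum w J = (1::real)"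
  obtains \<nu> where "set_pmf \<nu> \<subseteq> J" "\<And>j. j \<in> J \<Longrightarrow> pmf \<nu> j = w j"
proof -
  define f where "f j = (if j \<in> J then w j else 0)" for j
  have nn: "\<And>x. 0 \<le> f x" using w unfolding f_def by auto
  have "(\<integral>\<^sup>+x. ennreal (f x) \<partial>count_space UNIV) = (\<Sum>x\<in>J. ennreal (f x))"
    by (rule nn_integral_count_space'[OF J]) (auto simp: f_def)
  also have "\<dots> = ennreal (\<Sum>x\<in>J. f x)" using nn by (simp add: sum_ennreal)
  also have "(\<Sum>x\<in>J. f x) = 1" using s unfolding f_def by simp
  finally have int: "(\<integral>\<^sup>+x. ennreal (f x) \<partial>count_space UNIV) = 1" by simp
  show ?thesis
  proof (rule that[of "embed_pmf f"])
    show "set_pmf (embed_pmf f) \<subseteq> J"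
      unfolding set_embed_pmf[OF nn int] by (auto simp: f_def split: if_splits)
    show "pmf (embed_pmf f) j = w j" if "j \<in> J" for j
      using that by (simp add: pmf_embed_pmf[OF nn int] f_def)
  qed
qed

lemma expectation_finite:
  fixes f :: "'a \<Rightarrow> 'b::{banach, second_countable_topology}"
  assumes "finite (set_pmf M)"
  shows "measure_pmf.expectation M f = (\<Sum>\<omega>\<in>set_pmf M. pmf M \<omega> *\<^sub>R f \<omega>)"
  by (rule integral_measure_pmf[OF assms]) auto

lemma expectation_in_convex:
  fixes f :: "'a \<Rightarrow> 'b::euclidean_space"
  assumes fin: "finite (set_pmf M)" and C: "convex C" "f ` set_pmf M \<subseteq> C"
  shows "measure_pmf.expectation M f \<in> C"
  unfolding expectation_finite[OF fin]
  using fin C by (intro convex_sum) (auto simp: sum_pmf_eq_1)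

text \<open>It depends on the observed value and not on the sample point, so that it can define an
  estimator. At values of probability zero \<open>cond_pmf\<close> is unspecified.\<close>

definition conditional_mean :: "'a pmf \<Rightarrow> ('a \<Rightarrow> 'o) \<Rightarrow> ('a \<Rightarrow> 'b::euclidean_space) \<Rightarrow> 'o \<Rightarrow> 'b" where
  "conditional_mean M obs f o' = measure_pmf.expectation (cond_pmf M {\<omega>. obs \<omega> = o'}) f"

lemma conditional_mean_in_convex:
  assumes "finite (set_pmf M)" "convex C" "f ` set_pmf M \<subseteq> C" "\<omega> \<in> set_pmf M"
  shows "conditional_mean M obs f (obs \<omega>) \<in> C"
proof -
  have ne: "set_pmf M \<inter> {\<omega>'. obs \<omega>' = obs \<omega>} \<noteq> {}" using assms(4) by auto
  show ?thesis unfolding conditional_mean_def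
    by (rule expectation_in_convex) (use assms in \<open>auto simp: set_cond_pmf[OF ne]\<close>)
qed

text \<open>Sums are grouped by observed value; on each fibre \<open>y\<close> is constant and the
  conditional mean times the probability of the fibre is the weighted sum of \<open>f\<close>. The
  inner product form is needed with \<open>y\<close> the gradient of F at the posterior
  mean.\<close>

lemma tower_property:
  fixes f :: "'a \<Rightarrow> 'b::euclidean_space"
  assumes fin: "finite (set_pmf M)"
  shows "(\<Sum>\<omega>\<in>set_pmf M. pmf M \<omega> * (conditional_mean M obs f (obs \<omega>) \<bullet> y (obs \<omega>))) =
         (\<Sum>\<omega>\<in>set_pmf M. pmf M \<omega> * (f \<omega> \<bullet> y (obs \<omega>)))"
proof -
  let ?T = "obs ` set_pmf M" and ?S = "\<lambda>o'. {\<omega> \<in> set_pmf M. obs \<omega> = o'}"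
  have "(\<Sum>\<omega>\<in>?S o'. pmf M \<omega> * (conditional_mean M obs f (obs \<omega>) \<bullet> y (obs \<omega>))) =
      (\<Sum>\<omega>\<in>?S o'. pmf M \<omega> * (f \<omega> \<bullet> y (obs \<omega>)))" if o': "o' \<in> ?T" for o'
  proof -
    let ?E = "{\<omega>. obs \<omega> = o'}"
    have ne: "set_pmf M \<inter> ?E \<noteq> {}" using o' by auto
    have set: "set_pmf (cond_pmf M ?E) = ?S o'" unfolding set_cond_pmf[OF ne] by auto
    have "measure_pmf.prob M ?E = measure_pmf.prob M (?S o')"
      by (intro measure_prob_cong_0) (auto simp: set_pmf_iff)
    also have "\<dots> = (\<Sum>\<omega>\<in>?S o'. pmf M \<omega>)" using fin by (simp add: measure_measure_pmf_finite)
    finally have m: "measure_pmf.prob M ?E = (\<Sum>\<omega>\<in>?S o'. pmf M \<omega>)" .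
    have pos: "measure_pmf.prob M ?E \<noteq> 0" using ne by (simp add: measure_measure_pmf_not_zero)
    have cm: "conditional_mean M obs f o' = (\<Sum>\<omega>\<in>?S o'. (pmf M \<omega> / measure_pmf.prob M ?E) *\<^sub>R f \<omega>)"
      unfolding conditional_mean_def
      by (subst expectation_finite) (use fin in \<open>auto simp: set pmf_cond[OF ne]\<close>)
    have "(\<Sum>\<omega>\<in>?S o'. pmf M \<omega> * (conditional_mean M obs f (obs \<omega>) \<bullet> y (obs \<omega>))) =
        measure_pmf.prob M ?E * (conditional_mean M obs f o' \<bullet> y o')"
      unfolding m sum_distrib_right by (intro sum.cong) auto
    also have "\<dots> = (\<Sum>\<omega>\<in>?S o'. pmf M \<omega> * (f \<omega> \<bullet> y o'))"
      unfolding cm inner_sum_left sum_distrib_left using pos by (intro sum.cong) auto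
    finally show ?thesis by simp
  qed
  then have "(\<Sum>o'\<in>?T. \<Sum>\<omega>\<in>?S o'. pmf M \<omega> * (conditional_mean M obs f (obs \<omega>) \<bullet> y (obs \<omega>))) =
      (\<Sum>o'\<in>?T. \<Sum>\<omega>\<in>?S o'. pmf M \<omega> * (f \<omega> \<bullet> y (obs \<omega>)))"
    by (rule sum.cong[OF refl])
  then show ?thesis unfolding sum.group[OF fin finite_imageI[OF fin] subset_refl] .
qed

text \<open>The order is action, signal, as in the arguments of an estimator;
  \<open>posterior_mean\<close> conditions on the reversed pair, which gives the same
  events.\<close>

definition observation :: "('d::finite, 'z, 's) pm_game \<Rightarrow> ('z \<times> (real ^ 'd)) \<times> (real ^ 'd) \<Rightarrow> (real ^ 'd) \<times> 's" where
  "observation \<G> \<omega> = (snd \<omega>, signal \<G> (snd \<omega>) (fst (fst \<omega>)))"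

abbreviation target :: "('z \<times> 'v) \<times> 'v \<Rightarrow> 'v" where
  "target \<omega> \<equiv> snd (fst \<omega>)"

lemma posterior_mean_eq:
  "posterior_mean \<G> M \<omega> = conditional_mean M (observation \<G>) target (observation \<G> \<omega>)"
  unfolding posterior_mean_def conditional_mean_def observation_def
  by (simp add: case_prod_unfold conj_commute)

section \<open>The optimisation problem\<close>

text \<open>In the coordinates \<open>y = grad F q - (\<eta> / p a) *\<^sub>R g\<close> the objective is affine in the
  conjugate value \<open>F\<^sup>\<star> y\<close>. The estimators are therefore relaxed to pairs \<open>(y, h)\<close> in the epigraph of
  the conjugate; the relaxed objective is continuous, whereas \<open>F\<^sup>\<star>\<close> is only lower semicontinuous.\<close>

definition dual_epigraph :: "(('v::euclidean_space) \<Rightarrow> ereal) \<Rightarrow> real \<Rightarrow> ('v \<times> real) set" where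
  "dual_epigraph F R = {(y, h). norm y \<le> R \<and> \<bar>h\<bar> \<le> R \<and> (\<forall>x\<in>edom F. y \<bullet> x - rval F x \<le> h)}"

text \<open>Each Fenchel-Young constraint is a closed halfspace with normal (x, -1), which yields
  compactness and convexity together.\<close>

lemma dual_epigraph_Inter:
  "dual_epigraph F R = (cball 0 R \<times> {-R..R}) \<inter> (\<Inter>x\<in>edom F. {v. (x, -1) \<bullet> v \<le> rval F x})"
  unfolding dual_epigraph_def by (auto simp: inner_commute abs_le_iff algebra_simps)

lemma compact_dual_epigraph: "compact (dual_epigraph F R)"
  unfolding dual_epigraph_Inter
  by (intro compact_Int_closed compact_Times closed_INT ballI closed_halfspace_le) auto

lemma convex_dual_epigraph: "convex (dual_epigraph F R)"
  unfolding dual_epigraph_Inter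
  by (intro convex_Int convex_Times convex_INT convex_halfspace_le) auto

type_synonym ('d, 's) strategy =
  "(real ^ 'd \<Rightarrow> real) \<times> ((real ^ 'd) \<times> 's \<Rightarrow> (real ^ 'd) \<times> real)"

definition strategies ::
    "('d::finite, 'z, 's) pm_game \<Rightarrow> (real ^ 'd \<Rightarrow> ereal) \<Rightarrow> real \<Rightarrow> ('d, 's) strategy set" where
  "strategies \<G> F R =
     {(p, w). (\<forall>a. p a \<in> {0..1}) \<and> sum p (actions \<G>) = 1 \<and> (\<forall>k. w k \<in> dual_epigraph F R)}"

text \<open>This is what remains of \<Lambda> per unit of probability after substituting g = (p(a) /
  \<eta>) (grad F q - y), with \<open>snd v\<close> in place of the conjugate at y =
  \<open>fst v\<close>. For \<open>q\<close> in \<open>dom_grad F\<close> the subtracted constant is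
  the conjugate at \<open>grad F q\<close>.\<close>

definition surrogate_term ::
    "('d::finite, 'z, 's) pm_game \<Rightarrow> (real ^ 'd \<Rightarrow> ereal) \<Rightarrow> real ^ 'd \<Rightarrow> real \<Rightarrow>
     'z \<times> (real ^ 'd) \<Rightarrow> real ^ 'd \<Rightarrow> (real ^ 'd) \<times> real \<Rightarrow> real" where
  "surrogate_term \<G> F q \<eta> = (\<lambda>(z, b) a v. (a - b) \<bullet> loss \<G> z +
     1 / \<eta> * (b \<bullet> (grad F q - fst v) + snd v - (grad F q \<bullet> q - rval F q)))"

definition surrogate ::
    "('d::finite, 'z, 's) pm_game \<Rightarrow> (real ^ 'd \<Rightarrow> ereal) \<Rightarrow> real ^ 'd \<Rightarrow> real \<Rightarrow>
     'z \<times> (real ^ 'd) \<Rightarrow> ('d, 's) strategy \<Rightarrow> real" where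
  "surrogate \<G> F q \<eta> zb x = (\<Sum>a\<in>actions \<G>.
     fst x a * surrogate_term \<G> F q \<eta> zb a (snd x (a, signal \<G> a (fst zb))))"

lemma compact_strategies:
  "compact (strategies \<G> F R :: ('d::finite, 's) strategy set)"
proof -
  have "strategies \<G> F R = ({p. \<forall>a. p a \<in> {0..1}} \<inter> {p. sum p (actions \<G>) = 1}) \<times>
      {w. \<forall>k. w k \<in> dual_epigraph F R}"
    unfolding strategies_def by auto
  moreover have "closed {p :: real ^ 'd \<Rightarrow> real. sum p (actions \<G>) = 1}"
    by (intro closed_Collect_eq continuous_intros) auto
  ultimately show ?thesis
    by (simp only:) (intro compact_Times compact_Int_closed compact_functions compact_dual_epigraph compact_Icc)
qed

lemma continuous_surrogate:
  fixes \<G> :: "('d::finite, 'z, 's) pm_game"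
  shows "continuous_on UNIV (surrogate \<G> F q \<eta> zb)"
proof -
  have "continuous_on UNIV (\<lambda>x :: ('d, 's) strategy. fst x a)" for a
    by (rule continuous_on_product_then_coordinatewise[OF continuous_on_fst[OF continuous_on_id]])
  moreover have "continuous_on UNIV (\<lambda>x :: ('d, 's) strategy. snd x k)" for k
    by (rule continuous_on_product_then_coordinatewise[OF continuous_on_snd[OF continuous_on_id]])
  moreover obtain z b where "zb = (z, b)" by force
  moreover define k where "k = 1 / \<eta>"
  ultimately show ?thesis
    unfolding surrogate_def surrogate_term_def by (auto simp flip: k_def intro!: continuous_intros)
qed

text \<open>The weighted pair \<open>p a *\<^sub>R w (a, \<sigma>)\<close> mixes linearly, as \<open>g a \<sigma>\<close> does.\<close>

lemma convexlike_surrogate: "convexlike (strategies \<G> F R) I (surrogate \<G> F q \<eta>)"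
  unfolding convexlike_def
proof (intro ballI)
  fix x1 x2 t assume x: "x1 \<in> strategies \<G> F R" "x2 \<in> strategies \<G> F R" and t: "t \<in> {0..1::real}"
  obtain p1 w1 p2 w2 where xs: "x1 = (p1, w1)" "x2 = (p2, w2)" by force
  define p where "p a = (1 - t) * p1 a + t * p2 a" for a
  \<comment> \<open>Each component is averaged with weights proportional to its probability of
    playing the action. If the mixture never plays it, both weights vanish and \<open>w1 k\<close>
    only serves to stay in the epigraph.\<close>
  define w where "w k = (if p (fst k) = 0 then w1 k
    else ((1 - t) * p1 (fst k) / p (fst k)) *\<^sub>R w1 k + (t * p2 (fst k) / p (fst k)) *\<^sub>R w2 k)" for k
  have nn: "0 \<le> (1 - t) * p1 a" "0 \<le> t * p2 a" for a
    using x t unfolding xs strategies_def by auto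
  have w: "p a *\<^sub>R w (a, s) = ((1 - t) * p1 a) *\<^sub>R w1 (a, s) + (t * p2 a) *\<^sub>R w2 (a, s)" for a s
  proof (cases "p a = 0")
    case True
    then have "(1 - t) * p1 a = 0" "t * p2 a = 0" using nn[of a] unfolding p_def by linarith+
    then show ?thesis using True by (simp only:) simp
  qed (simp add: w_def scaleR_add_right)
  have "(p, w) \<in> strategies \<G> F R"
    unfolding strategies_def
  proof (clarify, intro conjI allI)
    fix a
    have "p1 a \<in> {0..1}" "p2 a \<in> {0..1}" using x unfolding xs strategies_def by auto
    then have "(1 - t) *\<^sub>R p1 a + t *\<^sub>R p2 a \<in> {0..1}"
      using t by (intro convexD) (auto simp: convex_real_interval)
    then show "p a \<in> {0..1}" unfolding p_def by simp
  next
    show "sum p (actions \<G>) = 1"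
      using x unfolding xs strategies_def p_def by (simp add: sum.distrib flip: sum_distrib_left)
  next
    fix k
    have W: "w1 k \<in> dual_epigraph F R" "w2 k \<in> dual_epigraph F R"
      using x unfolding xs strategies_def by (cases k; auto)+
    show "w k \<in> dual_epigraph F R"
    proof (cases "p (fst k) = 0")
      case False
      have "(1 - t) * p1 (fst k) / p (fst k) + t * p2 (fst k) / p (fst k) = 1"
        using False by (simp add: p_def flip: add_divide_distrib)
      moreover have "0 \<le> p (fst k)" using nn[of "fst k"] unfolding p_def by simp
      ultimately show ?thesis unfolding w_def
        using False nn[of "fst k"] by (auto intro!: convexD[OF convex_dual_epigraph] W divide_nonneg_nonneg)
    qed (use W in \<open>simp add: w_def\<close>)
  qed
  moreover have "surrogate \<G> F q \<eta> zb (p, w) = (1 - t) * surrogate \<G> F q \<eta> zb x1 + t * surrogate \<G> F q \<eta> zb x2" for zb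
  proof -
    obtain z b where zb: "zb = (z, b)" by force
    have "p a * surrogate_term \<G> F q \<eta> zb a (w (a, s)) =
        (1 - t) * (p1 a * surrogate_term \<G> F q \<eta> zb a (w1 (a, s))) +
        t * (p2 a * surrogate_term \<G> F q \<eta> zb a (w2 (a, s)))" for a s
    proof -
      define c where "c = (a - b) \<bullet> loss \<G> z + 1 / \<eta> * (b \<bullet> grad F q - (grad F q \<bullet> q - rval F q))"
      define k where "k = 1 / \<eta>"
      have T: "surrogate_term \<G> F q \<eta> zb a v = c + k * ((- b, 1) \<bullet> v)" for v
        unfolding surrogate_term_def zb c_def k_def by (cases v) (simp add: inner_diff_right diff_divide_distrib add_divide_distrib)
      have "p a * ((- b, 1) \<bullet> w (a, s)) = (- b, 1) \<bullet> (p a *\<^sub>R w (a, s))" by simp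
      also have "\<dots> = (1 - t) * p1 a * ((- b, 1) \<bullet> w1 (a, s)) + t * p2 a * ((- b, 1) \<bullet> w2 (a, s))"
        unfolding w by (simp add: inner_add_right)
      finally have "p a * c + k * (p a * ((- b, 1) \<bullet> w (a, s))) = ((1 - t) * p1 a + t * p2 a) * c +
          k * ((1 - t) * p1 a * ((- b, 1) \<bullet> w1 (a, s)) + t * p2 a * ((- b, 1) \<bullet> w2 (a, s)))"
        by (simp add: p_def)
      then show ?thesis unfolding T by (simp add: algebra_simps)
    qed
    then show ?thesis unfolding surrogate_def xs
      by (simp add: sum.distrib sum_distrib_left)
  qed
  ultimately show "\<exists>w\<in>strategies \<G> F R. \<forall>i\<in>I.
      surrogate \<G> F q \<eta> i w \<le> (1 - t) * surrogate \<G> F q \<eta> i x1 + t * surrogate \<G> F q \<eta> i x2"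
    by (intro bexI[of _ "(p, w)"]) auto
qed

section \<open>The value against a fixed prior\<close>

lemma youngs_information:
  fixes I r \<beta> lam :: real
  assumes "0 \<le> I" "0 < r" "0 < \<beta>" "1 < lam"
  shows "\<beta> powr (1 - 1/lam) * I powr (1/lam) \<le>
         I / (lam * r powr (1 - 1/lam)) + (1 - 1/lam) * \<beta> * r powr (1/lam)"
proof (cases "I = 0")
  case True
  then show ?thesis using assms by simp
next
  case False
  define a where "a = 1/lam"
  have a: "0 < a" "a < 1" using assms unfolding a_def by auto
  have I: "0 < I" using False assms by simp
  \<comment> \<open>The powers of \<open>r\<close> are chosen to cancel in the product on the left
    while the first term on the right becomes \<open>I / \<eta>\<close> for \<eta> =
    \<open>lam * r powr (1 - 1 / lam)\<close>.\<close>
  have "(I * r powr (a - 1)) powr a * (\<beta> * r powr a) powr (1 - a) \<le>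
      a * (I * r powr (a - 1)) + (1 - a) * (\<beta> * r powr a)"
    using a I assms by (intro Youngs_inequality_0) auto
  moreover have "(I * r powr (a - 1)) powr a * (\<beta> * r powr a) powr (1 - a) = \<beta> powr (1 - a) * I powr a"
  proof -
    have "r powr ((a - 1) * a) * r powr (a * (1 - a)) = 1"
    proof -
      have "(a - 1) * a + a * (1 - a) = 0" by (simp add: algebra_simps)
      then show ?thesis using assms by (simp flip: powr_add)
    qed
    then show ?thesis using I assms by (simp add: powr_mult powr_powr)
  qed
  moreover have "a * (I * r powr (a - 1)) = I / (lam * r powr (1 - a))"
  proof -
    have "r powr (a - 1) = inverse (r powr (1 - a))" by (simp flip: powr_minus)
    then show ?thesis by (simp add: a_def[symmetric] divide_inverse_commute) (simp add: a_def field_simps)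
  qed
  ultimately show ?thesis unfolding a_def by (simp add: mult.assoc)
qed

text \<open>Given the prior and the distribution from the information ratio, every estimator uses
  the gradient at the posterior mean, where Fenchel-Young is an equality. Targets are restricted to
  \<open>C\<close> so that all posterior means stay in \<open>C\<close>, where F is differentiable
  and the dual pairs lie in the epigraph with one common \<open>R\<close>.\<close>

lemma averaged_surrogate_bound:
  fixes \<G> :: "('d::finite, 'z, 's) pm_game" and q :: "real ^ 'd"
  assumes F: "legendre F" and A: "finite (actions \<G>)"
    and C: "convex C" "C \<subseteq> D" "C \<subseteq> dom_grad F" "q \<in> C"
    and R: "\<And>x. x \<in> C \<Longrightarrow> (grad F x, grad F x \<bullet> x - rval F x) \<in> dual_epigraph F R"
    and ir: "has_information_ratio \<G> F D \<alpha> \<beta> lam"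
    and par: "1 < lam" "0 < \<beta>" "0 < r" "\<eta> = lam * r powr (1 - 1 / lam)"
    and J: "finite J" "J \<subseteq> latent \<G> \<times> C" and wt: "\<forall>i\<in>J. 0 \<le> wt i" "sum wt J = 1"
  shows "\<exists>x\<in>strategies \<G> F R.
    (\<Sum>i\<in>J. wt i * surrogate \<G> F q \<eta> i x) \<le> \<alpha> + (1 - 1 / lam) * \<beta> * r powr (1 / lam)"
proof -
  obtain \<nu> where \<nu>: "set_pmf \<nu> \<subseteq> J" "\<And>j. j \<in> J \<Longrightarrow> pmf \<nu> j = wt j"
    using pmf_of_weights[OF J(1) wt] by blast
  have fin\<nu>: "finite (set_pmf \<nu>)" using \<nu>(1) J(1) finite_subset by blast
  moreover have "set_pmf \<nu> \<subseteq> latent \<G> \<times> D" using \<nu>(1) J(2) C(2) by blast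
  ultimately obtain p where p: "set_pmf p \<subseteq> actions \<G>"
    "ereal (measure_pmf.expectation (pair_pmf \<nu> p) (\<lambda>((z, b), a). (a - b) \<bullet> loss \<G> z))
         \<le> ereal \<alpha> + ereal (\<beta> powr (1 - 1 / lam)) *
             ereal_powr (information_gain \<G> F (pair_pmf \<nu> p)) (1 / lam)"
    using ir[unfolded has_information_ratio_def, rule_format, of \<nu>] par(1) by auto
  define M where "M = pair_pmf \<nu> p"
  have setM: "set_pmf M = set_pmf \<nu> \<times> set_pmf p" unfolding M_def by simp
  have finM: "finite (set_pmf M)" unfolding setM using fin\<nu> p(1) A finite_subset by blast
  have targetC: "target ` set_pmf M \<subseteq> C" using setM \<nu>(1) J(2) by auto
  define Y where "Y = conditional_mean M (observation \<G>) target"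
  define m where "m = measure_pmf.expectation M target"
  define avg where "avg h = (\<Sum>\<omega>\<in>set_pmf M. pmf M \<omega> * h \<omega>)" for h
  have avg_linear: "avg (\<lambda>\<omega>. h \<omega> + k \<omega>) = avg h + avg k" "avg (\<lambda>\<omega>. c * h \<omega>) = c * avg h"
    "avg (\<lambda>\<omega>. h \<omega> - k \<omega>) = avg h - avg k" for h k c
    unfolding avg_def by (simp_all add: sum.distrib sum_subtractf sum_distrib_left algebra_simps)
  have avg_const: "avg (\<lambda>_. c) = c" for c
    unfolding avg_def using sum_pmf_eq_1[OF finM subset_refl] by (simp flip: sum_distrib_right)
  have Y: "Y (observation \<G> \<omega>) \<in> C" if "\<omega> \<in> set_pmf M" for \<omega>
    unfolding Y_def by (rule conditional_mean_in_convex[OF finM C(1) targetC that])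
  have mC: "m \<in> C" unfolding m_def by (rule expectation_in_convex[OF finM C(1) targetC])
  have avg_target: "avg (\<lambda>\<omega>. target \<omega> \<bullet> v) = m \<bullet> v" for v
    unfolding avg_def m_def expectation_finite[OF finM] inner_sum_left by simp
  have tower: "avg (\<lambda>\<omega>. Y (observation \<G> \<omega>) \<bullet> y (observation \<G> \<omega>)) = avg (\<lambda>\<omega>. target \<omega> \<bullet> y (observation \<G> \<omega>))" for y
    unfolding avg_def Y_def by (rule tower_property[OF finM])
  have avg_Y: "avg (\<lambda>\<omega>. Y (observation \<G> \<omega>) \<bullet> v) = m \<bullet> v" for v
    using tower[of "\<lambda>_. v"] avg_target by simp
  define FY where "FY = avg (\<lambda>\<omega>. rval F (Y (observation \<G> \<omega>)))"
  have edomC: "x \<in> edom F" if "x \<in> C" for x using that C(3) dom_grad_edom by blast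
  \<comment> \<open>The posterior mean has expectation \<open>m\<close>, so the gradient terms of
    the divergences average to zero.\<close>
  have gain: "information_gain \<G> F M = ereal (FY - rval F m)"
  proof -
    have tgt: "measure_pmf.expectation M (\<lambda>((z, b), a). b) = m"
      unfolding m_def by (simp add: case_prod_unfold)
    have "information_gain \<G> F M = (\<Sum>\<omega>\<in>set_pmf M. ereal (pmf M \<omega> *
        (rval F (Y (observation \<G> \<omega>)) - rval F m - grad F m \<bullet> (Y (observation \<G> \<omega>) - m))))"
      unfolding information_gain_def tgt posterior_mean_eq Y_def[symmetric]
      using bregman_real[OF F edomC[OF Y] subsetD[OF C(3) mC]] by (intro sum.cong) auto
    also have "\<dots> = ereal (avg (\<lambda>\<omega>. rval F (Y (observation \<G> \<omega>)) - rval F m - (Y (observation \<G> \<omega>) \<bullet> grad F m - m \<bullet> grad F m)))"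
      unfolding avg_def by (simp add: inner_diff_right inner_commute)
    also have "\<dots> = ereal (FY - rval F m)"
      by (simp only: avg_linear avg_const avg_Y FY_def) simp
    finally show ?thesis .
  qed
  have gain_nonneg: "0 \<le> FY - rval F m"
  proof -
    have "0 \<le> avg (\<lambda>\<omega>. rval F (Y (observation \<G> \<omega>)) - rval F m - (Y (observation \<G> \<omega>) \<bullet> grad F m - m \<bullet> grad F m))"
      unfolding avg_def
    proof (intro sum_nonneg mult_nonneg_nonneg)
      fix \<omega> assume "\<omega> \<in> set_pmf M"
      from grad_inequality[OF F subsetD[OF C(3) mC] edomC[OF Y[OF this]]]
      show "0 \<le> rval F (Y (observation \<G> \<omega>)) - rval F m - (Y (observation \<G> \<omega>) \<bullet> grad F m - m \<bullet> grad F m)"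
        by (simp add: inner_diff_right inner_commute)
    qed simp
    also have "\<dots> = FY - rval F m" by (simp only: avg_linear avg_const avg_Y FY_def diff_self diff_zero)
    finally show ?thesis .
  qed
  define regr where "regr = avg (\<lambda>\<omega>. (snd \<omega> - target \<omega>) \<bullet> loss \<G> (fst (fst \<omega>)))"
  have "regr \<le> \<alpha> + \<beta> powr (1 - 1 / lam) * (FY - rval F m) powr (1 / lam)"
  proof -
    have "measure_pmf.expectation M (\<lambda>((z, b), a). (a - b) \<bullet> loss \<G> z) = regr"
      unfolding expectation_finite[OF finM] regr_def avg_def by (simp add: case_prod_unfold)
    then show ?thesis using p(2) unfolding M_def[symmetric] gain ereal_powr_def by simp
  qed
  also have "\<dots> \<le> \<alpha> + ((FY - rval F m) / \<eta> + (1 - 1 / lam) * \<beta> * r powr (1 / lam))"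
    using youngs_information[OF gain_nonneg par(3,2,1)] unfolding par(4) by simp
  finally have regr: "regr \<le> \<alpha> + ((FY - rval F m) / \<eta> + (1 - 1 / lam) * \<beta> * r powr (1 / lam))" .
  have \<eta>: "0 < \<eta>" using par by simp

  \<comment> \<open>Strategies are total in the observation; the value \<open>q\<close> at
    observations outside the support keeps the point in \<open>C\<close>.\<close>
  define X where "X k = (if k \<in> observation \<G> ` set_pmf M then Y k else q)" for k
  have XC: "X k \<in> C" for k unfolding X_def using Y C(4) by auto
  define w where "w k = (grad F (X k), grad F (X k) \<bullet> X k - rval F (X k))" for k
  define x where "x = (pmf p, w)"
  have "x \<in> strategies \<G> F R"
    unfolding x_def strategies_def w_def using R[OF XC] sum_pmf_eq_1[OF A p(1)] by (auto simp: pmf_le_1)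
  moreover have "(\<Sum>i\<in>J. wt i * surrogate \<G> F q \<eta> i x) \<le> \<alpha> + (1 - 1 / lam) * \<beta> * r powr (1 / lam)"
  proof -
    let ?u = "grad F q"
    define T where "T \<omega> = surrogate_term \<G> F q \<eta> (fst \<omega>) (snd \<omega>) (w (observation \<G> \<omega>))" for \<omega>
    have "(\<Sum>i\<in>J. wt i * surrogate \<G> F q \<eta> i x) = (\<Sum>i\<in>J. \<Sum>a\<in>actions \<G>. pmf M (i, a) * T (i, a))"
      unfolding surrogate_def sum_distrib_left x_def M_def pmf_pair T_def observation_def
      using \<nu>(2) by (intro sum.cong) (auto simp: mult.assoc)
    also have "\<dots> = (\<Sum>\<omega>\<in>J \<times> actions \<G>. pmf M \<omega> * T \<omega>)"
      by (simp add: sum.cartesian_product case_prod_unfold)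
    also have "\<dots> = avg T"
      unfolding avg_def
    proof (rule sum.mono_neutral_right)
      show "set_pmf M \<subseteq> J \<times> actions \<G>" using \<nu>(1) p(1) setM by auto
      show "\<forall>\<omega>\<in>J \<times> actions \<G> - set_pmf M. pmf M \<omega> * T \<omega> = 0" by (simp add: set_pmf_iff)
    qed (use J(1) A in simp)
    also have "\<dots> = avg (\<lambda>\<omega>. (snd \<omega> - target \<omega>) \<bullet> loss \<G> (fst (fst \<omega>)) +
        1 / \<eta> * (target \<omega> \<bullet> ?u - target \<omega> \<bullet> grad F (Y (observation \<G> \<omega>)) +
          (Y (observation \<G> \<omega>) \<bullet> grad F (Y (observation \<G> \<omega>)) - rval F (Y (observation \<G> \<omega>)))
          - (?u \<bullet> q - rval F q)))"
      unfolding avg_def T_def surrogate_term_def w_def X_def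
      by (intro sum.cong) (auto simp: case_prod_unfold inner_diff_right inner_commute[of _ "Y _"])
    \<comment> \<open>The gradient at the posterior mean is a function of the observation, so by the
      tower property its pairings with the target and with the posterior mean cancel, leaving only
      \<open>- FY\<close>.\<close>
    also have "\<dots> = regr + 1 / \<eta> * (m \<bullet> ?u - FY - (?u \<bullet> q - rval F q))"
      by (simp only: avg_linear avg_const avg_target tower[of "\<lambda>k. grad F (Y k)"] regr_def[symmetric] FY_def[symmetric]) simp
    \<comment> \<open>The difference of the two sides is the divergence of \<open>m\<close> from
      \<open>q\<close>, which is nonnegative: among all reference points, the mean minimises the
      expected divergence.\<close>
    also have "m \<bullet> ?u - FY - (?u \<bullet> q - rval F q) \<le> - (FY - rval F m)"
      using grad_inequality[OF F subsetD[OF C(3) C(4)] edomC[OF mC]]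
      by (simp add: inner_diff_right inner_commute)
    finally have "(\<Sum>i\<in>J. wt i * surrogate \<G> F q \<eta> i x) \<le> regr - (FY - rval F m) / \<eta>"
      using \<eta> by (simp add: mult_left_mono divide_right_mono diff_divide_distrib)
    then show ?thesis using regr by simp
  qed
  ultimately show ?thesis by blast
qed

text \<open>Full support makes the change of coordinates invertible, and the linear and \<Psi> terms
  recombine into the surrogate. The inequality is due only to the epigraph variable dominating the
  conjugate.\<close>

lemma Lambda_le_surrogate:
  fixes \<G> :: "('d::finite, 'z, 's) pm_game"
  assumes F: "legendre F" and q: "q \<in> dom_grad F" and "0 < \<eta>"
    and p: "set_pmf p = actions \<G>" and w: "\<And>k. w k \<in> dual_epigraph F R"
  shows "Lambda \<G> F q \<eta> z b p (\<lambda>a \<sigma>. (pmf p a / \<eta>) *\<^sub>R (grad F q - fst (w (a, \<sigma>))))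
    \<le> ereal (surrogate \<G> F q \<eta> (z, b) (pmf p, w))"
proof -
  let ?u = "grad F q"
  define y h where "y a = fst (w (a, signal \<G> a z))" and "h a = snd (w (a, signal \<G> a z))" for a
  have pos: "0 < pmf p a" if "a \<in> actions \<G>" for a
    using that p by (metis pmf_positive)
  have Psi: "Psi F q ((\<eta> / pmf p a) *\<^sub>R ((pmf p a / \<eta>) *\<^sub>R (?u - y a))) \<le>
      ereal (h a + (rval F q - ?u \<bullet> q + q \<bullet> (?u - y a)))" if a: "a \<in> actions \<G>" for a
  proof -
    have le: "fenchel_conj F (y a) \<le> ereal (h a)"
      unfolding fenchel_conj_le_iff[OF F] using w[of "(a, signal \<G> a z)"]
      unfolding dual_epigraph_def y_def h_def by auto
    have "Psi F q (?u - y a) \<le> ereal (h a + (rval F q - ?u \<bullet> q + q \<bullet> (?u - y a)))"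
      using add_right_mono[OF le, of "ereal (rval F q - ?u \<bullet> q + q \<bullet> (?u - y a))"]
      unfolding Psi_eq[OF F q] by simp
    then show ?thesis using pos[OF a] \<open>0 < \<eta>\<close> by simp
  qed
  have "(\<Sum>a\<in>actions \<G>. ereal (pmf p a) * Psi F q ((\<eta> / pmf p a) *\<^sub>R ((pmf p a / \<eta>) *\<^sub>R (?u - y a))))
      \<le> (\<Sum>a\<in>actions \<G>. ereal (pmf p a) * ereal (h a + (rval F q - ?u \<bullet> q + q \<bullet> (?u - y a))))"
    using Psi by (intro sum_mono ereal_mult_left_mono) auto
  also have "\<dots> = ereal (\<Sum>a\<in>actions \<G>. pmf p a * (h a + (rval F q - ?u \<bullet> q + q \<bullet> (?u - y a))))"
    by simp
  finally have "Lambda \<G> F q \<eta> z b p (\<lambda>a \<sigma>. (pmf p a / \<eta>) *\<^sub>R (?u - fst (w (a, \<sigma>)))) \<le>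
      ereal (\<Sum>a\<in>actions \<G>. pmf p a * ((a - b) \<bullet> loss \<G> z)) +
      ereal ((b - q) \<bullet> (\<Sum>a\<in>actions \<G>. (pmf p a / \<eta>) *\<^sub>R (?u - y a))) +
      ereal (1 / \<eta>) * ereal (\<Sum>a\<in>actions \<G>. pmf p a * (h a + (rval F q - ?u \<bullet> q + q \<bullet> (?u - y a))))"
    unfolding Lambda_def y_def[symmetric] using \<open>0 < \<eta>\<close>
    by (intro add_left_mono ereal_mult_left_mono) auto
  also have "\<dots> = ereal (\<Sum>a\<in>actions \<G>. pmf p a * ((a - b) \<bullet> loss \<G> z) +
      pmf p a / \<eta> * ((b - q) \<bullet> (?u - y a)) + pmf p a / \<eta> * (h a + (rval F q - ?u \<bullet> q + q \<bullet> (?u - y a))))"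
    by (simp add: inner_sum_right sum.distrib sum_distrib_left)
  also have "\<dots> = ereal (surrogate \<G> F q \<eta> (z, b) (pmf p, w))"
  proof -
    have "pmf p a * ((a - b) \<bullet> loss \<G> z) + pmf p a / \<eta> * ((b - q) \<bullet> (?u - y a)) +
          pmf p a / \<eta> * (h a + (rval F q - ?u \<bullet> q + q \<bullet> (?u - y a))) =
        pmf p a * surrogate_term \<G> F q \<eta> (z, b) a (w (a, signal \<G> a z))" for a
    proof -
      have eq: "b \<bullet> (?u - y a) + h a - (?u \<bullet> q - rval F q) =
          (b - q) \<bullet> (?u - y a) + (h a + (rval F q - ?u \<bullet> q + q \<bullet> (?u - y a)))"
        by (simp add: inner_diff_left)
      show ?thesis
        unfolding surrogate_term_def prod.case y_def[symmetric] h_def[symmetric] eq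
        by (simp only: distrib_left times_divide_eq_left times_divide_eq_right mult_1 add.assoc)
    qed
    then show ?thesis unfolding surrogate_def by simp
  qed
  finally show ?thesis .
qed

section \<open>Bounds on losses and on the surrogate\<close>

lemma hull_loss_bounds:
  assumes "standing_assumptions \<G> F D" "b \<in> convex hull (actions \<G>)" "z \<in> latent \<G>"
  shows "0 \<le> b \<bullet> loss \<G> z" "b \<bullet> loss \<G> z \<le> 1"
proof -
  have "actions \<G> \<subseteq> {v. loss \<G> z \<bullet> v \<ge> 0} \<inter> {v. loss \<G> z \<bullet> v \<le> 1}"
    using assms(1,3) unfolding standing_assumptions_def by (auto simp: inner_commute)
  moreover have "convex ({v. loss \<G> z \<bullet> v \<ge> 0} \<inter> {v. loss \<G> z \<bullet> v \<le> 1})"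
    by (intro convex_Int convex_halfspace_le convex_halfspace_ge)
  ultimately have "convex hull (actions \<G>) \<subseteq> {v. loss \<G> z \<bullet> v \<ge> 0} \<inter> {v. loss \<G> z \<bullet> v \<le> 1}"
    by (rule hull_minimal)
  then show "0 \<le> b \<bullet> loss \<G> z" "b \<bullet> loss \<G> z \<le> 1" using assms(2) by (auto simp: inner_commute)
qed

lemma loss_difference_bounds:
  assumes "standing_assumptions \<G> F D" "a \<in> actions \<G>" "b \<in> D" "z \<in> latent \<G>"
  shows "- 1 \<le> (a - b) \<bullet> loss \<G> z" "(a - b) \<bullet> loss \<G> z \<le> 1"
proof -
  have "a \<in> convex hull (actions \<G>)" "b \<in> convex hull (actions \<G>)"
    using assms(1-3) hull_subset[of "actions \<G>"] unfolding standing_assumptions_def by blast+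
  then show "- 1 \<le> (a - b) \<bullet> loss \<G> z" "(a - b) \<bullet> loss \<G> z \<le> 1"
    using hull_loss_bounds[OF assms(1) _ assms(4)] by (auto simp: inner_diff_left) (smt (verit))+
qed

text \<open>At the target \<open>q\<close> the estimation part is the Fenchel-Young gap at
  \<open>q\<close>, hence nonnegative; what is left is an average of loss differences.\<close>

lemma surrogate_at_centre_ge:
  fixes \<G> :: "('d::finite, 'z, 's) pm_game"
  assumes S: "standing_assumptions \<G> F D" and q: "q \<in> D" and "z \<in> latent \<G>" and "0 < \<eta>"
    and x: "x \<in> strategies \<G> F R"
  shows "- 1 \<le> surrogate \<G> F q \<eta> (z, q) x"
proof -
  obtain p w where xs: "x = (p, w)" by force
  have p: "\<And>a. 0 \<le> p a" "sum p (actions \<G>) = 1" and w: "\<And>k. w k \<in> dual_epigraph F R"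
    using x unfolding xs strategies_def by auto
  have "- 1 \<le> surrogate_term \<G> F q \<eta> (z, q) a (w (a, signal \<G> a z))" if "a \<in> actions \<G>" for a
  proof -
    have "q \<in> edom F" using S q unfolding standing_assumptions_def by blast
    then have "fst (w (a, signal \<G> a z)) \<bullet> q - rval F q \<le> snd (w (a, signal \<G> a z))"
      using w[of "(a, signal \<G> a z)"] unfolding dual_epigraph_def by auto
    then have "0 \<le> q \<bullet> (grad F q - fst (w (a, signal \<G> a z))) + snd (w (a, signal \<G> a z)) - (grad F q \<bullet> q - rval F q)"
      by (simp add: inner_diff_right inner_commute)
    then have "0 \<le> 1 / \<eta> * (q \<bullet> (grad F q - fst (w (a, signal \<G> a z))) + snd (w (a, signal \<G> a z)) - (grad F q \<bullet> q - rval F q))"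
      using \<open>0 < \<eta>\<close> by simp
    then show ?thesis
      unfolding surrogate_term_def prod.case using loss_difference_bounds(1)[OF S that q \<open>z \<in> latent \<G>\<close>] by linarith
  qed
  then have "(\<Sum>a\<in>actions \<G>. p a * (- 1)) \<le> surrogate \<G> F q \<eta> (z, q) x"
    unfolding surrogate_def xs fst_conv snd_conv using p(1) by (intro sum_mono mult_left_mono) simp_all
  then show ?thesis using p(2) by (simp add: sum_negf)
qed

text \<open>The bound may depend on \<open>q\<close>, \<open>R\<close> and \<eta> but is uniform in
  latent state, target and strategy. It controls the cost of mixing in the uniform
  distribution.\<close>

lemma surrogate_bounded:
  fixes \<G> :: "('d::finite, 'z, 's) pm_game"
  assumes S: "standing_assumptions \<G> F D" and "0 < \<eta>"
  obtains B where "0 \<le> B"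
    "\<And>z b x. z \<in> latent \<G> \<Longrightarrow> b \<in> D \<Longrightarrow> x \<in> strategies \<G> F R \<Longrightarrow> surrogate \<G> F q \<eta> (z, b) x \<le> B"
proof -
  have "bounded D" using S compact_imp_bounded unfolding standing_assumptions_def by blast
  then obtain N where N: "\<And>b. b \<in> D \<Longrightarrow> norm b \<le> N" unfolding bounded_iff by blast
  define c where "c = \<bar>grad F q \<bullet> q - rval F q\<bar>"
  define B where "B = 1 + 1 / \<eta> * (\<bar>N\<bar> * (norm (grad F q) + \<bar>R\<bar>) + \<bar>R\<bar> + c)"
  show ?thesis
  proof (rule that[of B])
    show "0 \<le> B" unfolding B_def c_def using \<open>0 < \<eta>\<close> by simp
  next
    fix z b x assume z: "z \<in> latent \<G>" and b: "b \<in> D" and x: "x \<in> strategies \<G> F R"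
    obtain p w where xs: "x = (p, w)" by force
    have p: "\<And>a. 0 \<le> p a" "sum p (actions \<G>) = 1" and w: "\<And>k. w k \<in> dual_epigraph F R"
      using x unfolding xs strategies_def by auto
    have bound: "surrogate_term \<G> F q \<eta> (z, b) a v \<le> B" if a: "a \<in> actions \<G>" and v: "v \<in> dual_epigraph F R" for a v
    proof -
      have vR: "norm (fst v) \<le> R" "\<bar>snd v\<bar> \<le> R" using v unfolding dual_epigraph_def by auto
      have "b \<bullet> (grad F q - fst v) \<le> norm b * norm (grad F q - fst v)" by (rule norm_cauchy_schwarz)
      also have "\<dots> \<le> \<bar>N\<bar> * (norm (grad F q) + \<bar>R\<bar>)"
        using N[OF b] vR norm_triangle_ineq4[of "grad F q" "fst v"] by (intro mult_mono) auto
      finally have "b \<bullet> (grad F q - fst v) + snd v - (grad F q \<bullet> q - rval F q) \<le>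
          \<bar>N\<bar> * (norm (grad F q) + \<bar>R\<bar>) + \<bar>R\<bar> + c"
        unfolding c_def using vR by linarith
      then have "1 / \<eta> * (b \<bullet> (grad F q - fst v) + snd v - (grad F q \<bullet> q - rval F q)) \<le>
          1 / \<eta> * (\<bar>N\<bar> * (norm (grad F q) + \<bar>R\<bar>) + \<bar>R\<bar> + c)"
        using \<open>0 < \<eta>\<close> by (intro mult_left_mono) auto
      then show ?thesis
        unfolding surrogate_term_def prod.case B_def using loss_difference_bounds(2)[OF S a b z] by linarith
    qed
    have "surrogate \<G> F q \<eta> (z, b) x \<le> (\<Sum>a\<in>actions \<G>. p a * B)"
      unfolding surrogate_def xs fst_conv snd_conv by (intro sum_mono mult_left_mono bound w p(1))
    then show "surrogate \<G> F q \<eta> (z, b) x \<le> B" using p(2) by (simp flip: sum_distrib_right)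
  qed
qed

lemma surrogate_affine_target:
  fixes \<G> :: "('d::finite, 'z, 's) pm_game"
  assumes "x \<in> strategies \<G> F R"
  shows "surrogate \<G> F q \<eta> (z, b - s *\<^sub>R (b - q)) x =
    (1 - s) * surrogate \<G> F q \<eta> (z, b) x + s * surrogate \<G> F q \<eta> (z, q) x"
proof -
  have "surrogate_term \<G> F q \<eta> (z, b - s *\<^sub>R (b - q)) a v =
      (1 - s) * surrogate_term \<G> F q \<eta> (z, b) a v + s * surrogate_term \<G> F q \<eta> (z, q) a v" for a v
  proof -
    define k where "k = 1 / \<eta>"
    show ?thesis unfolding surrogate_term_def prod.case k_def[symmetric]
      by (simp add: inner_diff_left algebra_simps)
  qed
  then show ?thesis
    unfolding surrogate_def sum_distrib_left sum.distrib[symmetric]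
    by (intro sum.cong refl) (simp only: fst_conv, simp add: algebra_simps)
qed

lemma surrogate_affine_distribution:
  "surrogate \<G> F q \<eta> zb (\<lambda>a. (1 - \<kappa>) * p a + \<kappa> * p' a, w) =
    (1 - \<kappa>) * surrogate \<G> F q \<eta> zb (p, w) + \<kappa> * surrogate \<G> F q \<eta> zb (p', w)"
  unfolding surrogate_def sum_distrib_left sum.distrib[symmetric]
  by (intro sum.cong) (simp_all add: algebra_simps)

text \<open>The minimax theorem needs uniformly bounded gradients, which hold only on the shrunken
  domain \<open>D\<^sub>s = (1 - s) D + s q\<close>, a compact subset of the interior of the domain of \<open>F\<close>. Since the
  objective is affine in the target and at least \<open>-1\<close> at the target \<open>q\<close>, passing from \<open>D\<^sub>s\<close> to \<open>D\<close>
  costs an amount that vanishes with \<open>s\<close>; mixing with the uniform distribution gives full support.\<close>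

lemma good_exploration_exists:
  fixes \<G> :: "('d::finite, 'z, 's) pm_game" and q :: "real ^ 'd"
  assumes S: "standing_assumptions \<G> F D"
    and ir: "has_information_ratio \<G> F D \<alpha> \<beta> lam"
    and par: "1 < lam" "0 < \<beta>" "0 < r" "\<eta> = lam * r powr (1 - 1 / lam)"
    and q: "q \<in> D" "q \<in> dom_grad F" and "0 < e"
  shows "\<exists>p g. set_pmf p = actions \<G> \<and>
    Lambda_sup \<G> F D q \<eta> p g \<le> ereal (\<alpha> + (1 - 1 / lam) * \<beta> * r powr (1 / lam) + e)"
proof -
  have F: "legendre F" and D: "compact D" "convex D" "D \<subseteq> edom F" and A: "finite (actions \<G>)" "actions \<G> \<noteq> {}"
    using S unfolding standing_assumptions_def by auto
  have \<eta>: "0 < \<eta>" using par by simp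
  define c where "c = \<alpha> + (1 - 1 / lam) * \<beta> * r powr (1 / lam)"
  \<comment> \<open>Solves \<open>s * (2 + \<bar>c\<bar> + e) = e / 2\<close>. Of the 2, one unit
    pays for the slack in the minimax theorem and one for the lower bound -1 at the target
    \<open>q\<close>; the rest absorbs the division by \<open>1 - s\<close>.\<close>
  define s where "s = (e / 2) / (2 + \<bar>c\<bar> + e)"
  have s: "0 < s" "s < 1" unfolding s_def using \<open>0 < e\<close> by (auto simp: divide_simps)
  have "s * (2 + \<bar>c\<bar> + e) = e / 2" unfolding s_def using \<open>0 < e\<close> by (simp add: field_simps)
  then have s_small: "s * 2 + s * \<bar>c\<bar> + s * e = e / 2" by (simp add: algebra_simps)
  define Ds where "Ds = (\<lambda>b. b - s *\<^sub>R (b - q)) ` D"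
  have shrink: "b - s *\<^sub>R (b - q) = (1 - s) *\<^sub>R b + s *\<^sub>R q" for b by (simp add: algebra_simps)
  have Ds: "compact Ds" "convex Ds" "Ds \<subseteq> D" "Ds \<subseteq> dom_grad F" "q \<in> Ds"
  proof -
    show "compact Ds" unfolding Ds_def by (intro compact_continuous_image D continuous_intros)
    have "Ds = (\<lambda>v. s *\<^sub>R q + v) ` ((\<lambda>b. (1 - s) *\<^sub>R b) ` D)"
      unfolding Ds_def shrink image_image by (simp add: add.commute)
    then show "convex Ds" using D(2) by (simp add: convex_scaling convex_translation)
    show "Ds \<subseteq> D" unfolding Ds_def shrink using convexD[OF D(2) _ q(1)] s by auto
    \<comment> \<open>As \<open>q\<close> is interior to the domain, shrinking towards it moves even
      boundary points of the domain into the interior.\<close>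
    show "Ds \<subseteq> dom_grad F"
      unfolding Ds_def interior_edom_eq_dom_grad[OF F, symmetric]
      using mem_interior_convex_shrink[OF convex_fun_edom[OF legendre_proper[OF F] legendre_convex[OF F]], of q _ s]
        s D(3) q(2) interior_edom_eq_dom_grad[OF F] by auto
    show "q \<in> Ds" unfolding Ds_def using q(1) by (intro image_eqI[of _ _ q]) auto
  qed
  obtain R0 where R0: "0 \<le> R0" "\<And>x. x \<in> Ds \<Longrightarrow> norm (grad F x) \<le> R0" "\<And>x. x \<in> Ds \<Longrightarrow> \<bar>rval F x\<bar> \<le> R0"
    using bounded_grad_on_compact[OF F Ds(1) Ds(4)] by blast
  obtain N where N: "\<And>x. x \<in> Ds \<Longrightarrow> norm x \<le> N"
    using compact_imp_bounded[OF Ds(1)] unfolding bounded_iff by blast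
  define R where "R = R0 * \<bar>N\<bar> + R0"
  have R: "(grad F x, grad F x \<bullet> x - rval F x) \<in> dual_epigraph F R" if x: "x \<in> Ds" for x
  proof -
    have "norm (grad F x) \<le> R" unfolding R_def using R0(1) R0(2)[OF x] by (simp add: add_increasing)
    moreover have "\<bar>grad F x \<bullet> x\<bar> \<le> R0 * \<bar>N\<bar>"
      using Cauchy_Schwarz_ineq2[of "grad F x" x] mult_mono[OF R0(2)[OF x], of "norm x" "\<bar>N\<bar>"] N[OF x] R0(1)
      by force
    then have "\<bar>grad F x \<bullet> x - rval F x\<bar> \<le> R" unfolding R_def using R0(3)[OF x] by linarith
    moreover have "grad F x \<bullet> y - rval F y \<le> grad F x \<bullet> x - rval F x" if "y \<in> edom F" for y
      using grad_inequality[OF F subsetD[OF Ds(4) x] that] by (simp add: inner_diff_right)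
    ultimately show ?thesis unfolding dual_epigraph_def by auto
  qed
  define unif where "unif a = (if a \<in> actions \<G> then 1 / real (card (actions \<G>)) else 0)" for a
  have unif: "unif a \<in> {0..1}" "sum unif (actions \<G>) = 1" "a \<in> actions \<G> \<Longrightarrow> 0 < unif a" for a
    using A unfolding unif_def by (auto simp: card_gt_0_iff Suc_leI)
  have "\<exists>x\<in>strategies \<G> F R. \<forall>i\<in>latent \<G> \<times> Ds. surrogate \<G> F q \<eta> i x \<le> c + s"
  proof (rule minimax_compact[OF compact_strategies _ continuous_surrogate convexlike_surrogate])
    show "strategies \<G> F R \<noteq> {}"
      unfolding strategies_def using unif R[OF Ds(5)]
      by (auto intro!: exI[of _ unif] exI[of _ "\<lambda>_. (grad F q, grad F q \<bullet> q - rval F q)"])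
    show "c < c + s" using s by simp
  next
    fix J wt assume "finite J" "J \<subseteq> latent \<G> \<times> Ds" "\<forall>i\<in>J. 0 \<le> wt i" "sum wt J = (1::real)"
    then show "\<exists>x\<in>strategies \<G> F R. (\<Sum>i\<in>J. wt i * surrogate \<G> F q \<eta> i x) \<le> c"
      unfolding c_def
      using averaged_surrogate_bound[OF F A(1) Ds(2,3,4,5) R ir par] by blast
  qed
  then obtain x where x: "x \<in> strategies \<G> F R" "\<And>z b. z \<in> latent \<G> \<Longrightarrow> b \<in> Ds \<Longrightarrow> surrogate \<G> F q \<eta> (z, b) x \<le> c + s"
    by blast
  have xD: "surrogate \<G> F q \<eta> (z, b) x \<le> c + e / 2" if z: "z \<in> latent \<G>" and b: "b \<in> D" for z b
  proof -
    have "(1 - s) * surrogate \<G> F q \<eta> (z, b) x + s * surrogate \<G> F q \<eta> (z, q) x \<le> c + s"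
      using x(2)[OF z, of "b - s *\<^sub>R (b - q)"] b surrogate_affine_target[OF x(1), of q \<eta> z b s]
      unfolding Ds_def by auto
    moreover have "s * (- 1) \<le> s * surrogate \<G> F q \<eta> (z, q) x"
      using surrogate_at_centre_ge[OF S q(1) z \<eta> x(1)] s by (intro mult_left_mono) auto
    ultimately have "(1 - s) * surrogate \<G> F q \<eta> (z, b) x \<le> c + s * 2" by linarith
    also have "\<dots> \<le> (1 - s) * (c + e / 2)"
    proof -
      have "s * c \<le> s * \<bar>c\<bar>" "0 \<le> s * e" using s \<open>0 < e\<close> by (auto intro: mult_left_mono)
      moreover have "(1 - s) * (c + e / 2) = c + e / 2 - s * c - s * e / 2" by (simp add: field_simps)
      ultimately show ?thesis using s_small by linarith
    qed
    finally show ?thesis using s by simp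
  qed
  obtain B where B: "0 \<le> B"
    "\<And>z b x. z \<in> latent \<G> \<Longrightarrow> b \<in> D \<Longrightarrow> x \<in> strategies \<G> F R \<Longrightarrow> surrogate \<G> F q \<eta> (z, b) x \<le> B"
    using surrogate_bounded[OF S \<eta>] by blast
  \<comment> \<open>Chosen such that \<open>(1 - \<kappa>) * (c + e / 2) + \<kappa> * B\<close> is
    at most \<open>c + e\<close>, also for negative \<open>c\<close>.\<close>
  define \<kappa> where "\<kappa> = (e / 2) / (B + \<bar>c\<bar> + e)"
  have \<kappa>: "0 < \<kappa>" "\<kappa> < 1" unfolding \<kappa>_def using \<open>0 < e\<close> B(1) by (auto simp: divide_simps add_nonneg_pos)
  have "\<kappa> * (B + \<bar>c\<bar> + e) = e / 2"
    unfolding \<kappa>_def using \<open>0 < e\<close> B(1) by (simp add: field_simps add_nonneg_pos)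
  then have \<kappa>_small: "\<kappa> * B + \<kappa> * \<bar>c\<bar> + \<kappa> * e = e / 2" by (simp add: algebra_simps)
  obtain p w where xs: "x = (p, w)" by force
  have p: "\<And>a. p a \<in> {0..1}" "sum p (actions \<G>) = 1" and w: "\<And>k. w k \<in> dual_epigraph F R"
    using x(1) unfolding xs strategies_def by auto
  define p' where "p' a = (1 - \<kappa>) * p a + \<kappa> * unif a" for a
  have p'_nonneg: "0 \<le> p' a" for a unfolding p'_def using p(1)[of a] unif(1)[of a] \<kappa> by simp
  have p'_pos: "0 < p' a" if "a \<in> actions \<G>" for a
    unfolding p'_def using p(1)[of a] unif(3)[OF that] \<kappa> by (intro add_nonneg_pos) auto
  have "sum p' (actions \<G>) = 1"
    unfolding p'_def sum.distrib sum_distrib_left[symmetric] p(2) unif(2) by simp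
  then obtain P where P: "set_pmf P \<subseteq> actions \<G>" "\<And>a. a \<in> actions \<G> \<Longrightarrow> pmf P a = p' a"
    using pmf_of_weights[OF A(1), of p'] p'_nonneg by blast
  have setP: "set_pmf P = actions \<G>"
    using P p'_pos by (force simp: set_pmf_iff)
  have surr: "surrogate \<G> F q \<eta> (z, b) (pmf P, w) \<le> c + e" if z: "z \<in> latent \<G>" and b: "b \<in> D" for z b
  proof -
    have "surrogate \<G> F q \<eta> (z, b) (pmf P, w) = surrogate \<G> F q \<eta> (z, b) (p', w)"
      unfolding surrogate_def using P(2) by simp
    also have "\<dots> = (1 - \<kappa>) * surrogate \<G> F q \<eta> (z, b) (p, w) + \<kappa> * surrogate \<G> F q \<eta> (z, b) (unif, w)"
      unfolding p'_def by (rule surrogate_affine_distribution)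
    also have "\<dots> \<le> (1 - \<kappa>) * (c + e / 2) + \<kappa> * B"
    proof (intro add_mono mult_left_mono)
      have "(unif, w) \<in> strategies \<G> F R" unfolding strategies_def using unif(1,2) w by auto
      then show "surrogate \<G> F q \<eta> (z, b) (unif, w) \<le> B" by (rule B(2)[OF z b])
    qed (use xD[OF z b] \<kappa> xs in auto)
    also have "\<dots> \<le> c + e"
    proof -
      have "- (\<kappa> * c) \<le> \<kappa> * \<bar>c\<bar>" "0 \<le> \<kappa> * e"
        using \<kappa> \<open>0 < e\<close> mult_left_mono[of "- c" "\<bar>c\<bar>" \<kappa>] by auto
      moreover have "(1 - \<kappa>) * (c + e / 2) = c + e / 2 - \<kappa> * c - \<kappa> * e / 2" by (simp add: field_simps)
      ultimately show ?thesis using \<kappa>_small by linarith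
    qed
    finally show ?thesis .
  qed
  let ?g = "\<lambda>a \<sigma>. (pmf P a / \<eta>) *\<^sub>R (grad F q - fst (w (a, \<sigma>)))"
  have "Lambda_sup \<G> F D q \<eta> P ?g \<le> ereal (c + e)"
    unfolding Lambda_sup_def
  proof (intro SUP_least)
    fix z b assume zb: "z \<in> latent \<G>" "b \<in> D"
    have "Lambda \<G> F q \<eta> z b P ?g \<le> ereal (surrogate \<G> F q \<eta> (z, b) (pmf P, w))"
      by (rule Lambda_le_surrogate[OF F q(2) \<eta> setP w])
    also have "\<dots> \<le> ereal (c + e)" using surr[OF zb] by simp
    finally show "Lambda \<G> F q \<eta> z b P ?g \<le> ereal (c + e)" .
  qed
  then show ?thesis unfolding c_def using setP by blast
qed

lemma Lambda_star_le:
  fixes \<G> :: "('d::finite, 'z, 's) pm_game"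
  assumes S: "standing_assumptions \<G> F D"
    and ir: "has_information_ratio \<G> F D \<alpha> \<beta> lam"
    and par: "1 < lam" "0 < \<beta>" "0 < r" "\<eta> = lam * r powr (1 - 1 / lam)"
  shows "Lambda_star \<G> F D \<eta> \<le> ereal (\<alpha> + (1 - 1 / lam) * \<beta> * r powr (1 / lam))"
  unfolding Lambda_star_def
proof (rule SUP_least)
  fix q assume "q \<in> D \<inter> dom_grad F"
  then have q: "q \<in> D" "q \<in> dom_grad F" by auto
  show "(INF p\<in>{p. set_pmf p = actions \<G>}. INF g. Lambda_sup \<G> F D q \<eta> p g) \<le>
      ereal (\<alpha> + (1 - 1 / lam) * \<beta> * r powr (1 / lam))"
  proof (rule ereal_le_epsilon2)
    fix e :: real assume "0 < e"
    obtain p g where pg: "set_pmf p = actions \<G>"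
      "Lambda_sup \<G> F D q \<eta> p g \<le> ereal (\<alpha> + (1 - 1 / lam) * \<beta> * r powr (1 / lam) + e)"
      using good_exploration_exists[OF S ir par q \<open>0 < e\<close>] by blast
    have "(INF p\<in>{p. set_pmf p = actions \<G>}. INF g. Lambda_sup \<G> F D q \<eta> p g) \<le> Lambda_sup \<G> F D q \<eta> p g"
      using pg(1) by (intro INF_lower2[of p] INF_lower2[of g]) auto
    also note pg(2)
    finally show "(INF p\<in>{p. set_pmf p = actions \<G>}. INF g. Lambda_sup \<G> F D q \<eta> p g) \<le>
        ereal (\<alpha> + (1 - 1 / lam) * \<beta> * r powr (1 / lam)) + ereal e" by simp
  qed
qed

section \<open>Regret analysis\<close>

text \<open>The summand sees the history before the round and the entry of the round, which is what
  iterates and estimates depend on. Appending an entry then adds one term, so inductions run over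
  rounds.\<close>

definition history_sum :: "('h list \<Rightarrow> 'h \<Rightarrow> 'b::comm_monoid_add) \<Rightarrow> 'h list \<Rightarrow> 'b" where
  "history_sum f h = (\<Sum>s<length h. f (take s h) (h ! s))"

lemma history_sum_Nil [simp]: "history_sum f [] = 0"
  by (simp add: history_sum_def)

lemma history_sum_snoc [simp]: "history_sum f (h @ [x]) = history_sum f h + f h x"
  by (simp add: history_sum_def nth_append)

lemma histories_Nil [simp]: "[] \<in> histories \<G>"
  by (simp add: histories_def)

lemma histories_snoc:
  "h @ [x] \<in> histories \<G> \<longleftrightarrow>
     h \<in> histories \<G> \<and> (\<exists>a\<in>actions \<G>. \<exists>z\<in>latent \<G>. x = (a, signal \<G> a z))"
  unfolding histories_def by auto

text \<open>Since every action has positive probability and \<Psi> is nonnegative, one infinite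
  \<Psi> term would make \<Lambda> infinite. All later calculations can hence be done in the reals,
  and \<Lambda> reads as an expectation over the played action, with importance-weighted
  estimates.\<close>

lemma Lambda_real:
  fixes \<G> :: "('d::finite, 'z, 's) pm_game"
  assumes F: "legendre F" and q: "q \<in> dom_grad F" and \<eta>: "0 < \<eta>" and A: "finite (actions \<G>)"
    and p: "set_pmf p = actions \<G>" and bound: "Lambda \<G> F q \<eta> z b p g \<le> ereal C"
  defines "est \<equiv> \<lambda>a. (1 / pmf p a) *\<^sub>R g a (signal \<G> a z)"
  shows "a \<in> actions \<G> \<Longrightarrow> \<bar>Psi F q (\<eta> *\<^sub>R est a)\<bar> \<noteq> \<infinity>"
    and "(\<Sum>a\<in>actions \<G>. pmf p a * ((a - b) \<bullet> loss \<G> z +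
      ((b - q) \<bullet> est a + real_of_ereal (Psi F q (\<eta> *\<^sub>R est a)) / \<eta>))) \<le> C"
proof -
  have pos: "0 < pmf p a" if "a \<in> actions \<G>" for a
    using that p by (metis pmf_positive)
  define ps where "ps a = Psi F q (\<eta> *\<^sub>R est a)" for a
  have ps_nonneg: "0 \<le> ps a" for a unfolding ps_def by (rule Psi_nonneg[OF F q])
  have L: "Lambda \<G> F q \<eta> z b p g = ereal (\<Sum>a\<in>actions \<G>. pmf p a * ((a - b) \<bullet> loss \<G> z))
     + ereal ((b - q) \<bullet> (\<Sum>a\<in>actions \<G>. g a (signal \<G> a z)))
     + ereal (1 / \<eta>) * (\<Sum>a\<in>actions \<G>. ereal (pmf p a) * ps a)"
    unfolding Lambda_def ps_def est_def by simp
  have fin: "ps a \<noteq> \<infinity>" if a: "a \<in> actions \<G>" for a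
  proof
    assume "ps a = \<infinity>"
    then have "ereal (pmf p a) * ps a = \<infinity>" using pos[OF a] by simp
    then have "(\<Sum>a\<in>actions \<G>. ereal (pmf p a) * ps a) = \<infinity>"
      using a A by (auto simp: sum_Pinfty)
    then have "Lambda \<G> F q \<eta> z b p g = \<infinity>" unfolding L using \<eta> by simp
    then show False using bound by simp
  qed
  have real: "ereal (pmf p a) * ps a = ereal (pmf p a * real_of_ereal (ps a))" if "a \<in> actions \<G>" for a
    using fin[OF that] ps_nonneg[of a] by (cases "ps a") auto
  show "\<bar>Psi F q (\<eta> *\<^sub>R est a)\<bar> \<noteq> \<infinity>" if "a \<in> actions \<G>"
    using fin[OF that] ps_nonneg[of a] unfolding ps_def by (cases "Psi F q (\<eta> *\<^sub>R est a)") auto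
  have "(\<Sum>a\<in>actions \<G>. ereal (pmf p a) * ps a) = ereal (\<Sum>a\<in>actions \<G>. pmf p a * real_of_ereal (ps a))"
    unfolding sum_ereal[symmetric] by (intro sum.cong refl real)
  with bound have "(\<Sum>a\<in>actions \<G>. pmf p a * ((a - b) \<bullet> loss \<G> z))
     + (b - q) \<bullet> (\<Sum>a\<in>actions \<G>. g a (signal \<G> a z))
     + 1 / \<eta> * (\<Sum>a\<in>actions \<G>. pmf p a * real_of_ereal (ps a)) \<le> C"
    unfolding L by simp
  moreover have "(\<Sum>a\<in>actions \<G>. g a (signal \<G> a z)) = (\<Sum>a\<in>actions \<G>. pmf p a *\<^sub>R est a)"
    unfolding est_def using pos by (intro sum.cong) force+
  ultimately show "(\<Sum>a\<in>actions \<G>. pmf p a * ((a - b) \<bullet> loss \<G> z +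
      ((b - q) \<bullet> est a + real_of_ereal (Psi F q (\<eta> *\<^sub>R est a)) / \<eta>))) \<le> C"
    unfolding ps_def[symmetric]
    by (simp add: inner_sum_right sum_distrib_left sum.distrib distrib_left)
qed

section \<open>A run of the algorithm with objective at most \<open>C\<close> in every round\<close>

context
  fixes \<G> :: "('d::finite, 'z, 's) pm_game" and F :: "real ^ 'd \<Rightarrow> ereal" and D :: "(real ^ 'd) set"
    and u :: update_rule and n :: nat and \<eta> \<epsilon> C :: real
    and P :: "('d, 's) history \<Rightarrow> (real ^ 'd) pmf"
    and E :: "('d, 's) history \<Rightarrow> real ^ 'd \<Rightarrow> 's \<Rightarrow> real ^ 'd"
    and Q :: "('d, 's) history \<Rightarrow> real ^ 'd"
  assumes S: "standing_assumptions \<G> F D"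
    and \<eta>: "0 < \<eta>"
    and algorithm: "exploration_by_optimisation \<G> F D u n \<eta> \<epsilon> P E Q"
    and bound: "\<And>h. h \<in> histories \<G> \<Longrightarrow> length h < n \<Longrightarrow> Lambda_sup \<G> F D (Q h) \<eta> (P h) (E h) \<le> ereal C"
begin

abbreviation (input) "estimate h x \<equiv> loss_estimate P E h (fst x) (snd x)"

abbreviation (input) "stability h x \<equiv> real_of_ereal (Psi F (Q h) (\<eta> *\<^sub>R estimate h x))"

abbreviation (input) "divergence b q \<equiv> rval F b - rval F q - grad F q \<bullet> (b - q)"

lemma
  shows legendre_potential: "legendre F" and convex_domain: "convex D" and domain_subset_edom: "D \<subseteq> edom F"
    and finite_actions: "finite (actions \<G>)"
  using S unfolding standing_assumptions_def by auto

lemma iterate: "h \<in> histories \<G> \<Longrightarrow> length h < n \<Longrightarrow> Q h \<in> D"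
  "h \<in> histories \<G> \<Longrightarrow> length h < n \<Longrightarrow> Q h \<in> dom_grad F"
  "h \<in> histories \<G> \<Longrightarrow> length h < n \<Longrightarrow> set_pmf (P h) = actions \<G>"
  using algorithm unfolding exploration_by_optimisation_def by auto

lemma Lambda_bound:
  assumes "h \<in> histories \<G>" "length h < n" "z \<in> latent \<G>" "b \<in> D"
  shows "Lambda \<G> F (Q h) \<eta> z b (P h) (E h) \<le> ereal C"
proof -
  have "Lambda \<G> F (Q h) \<eta> z b (P h) (E h) \<le> Lambda_sup \<G> F D (Q h) \<eta> (P h) (E h)"
    unfolding Lambda_sup_def using assms(3,4) by (intro SUP_upper2[of z] SUP_upper2[of b]) auto
  then show ?thesis using bound[OF assms(1,2)] by (rule order_trans)
qed

text \<open>The finite bound on \<Lambda> makes the \<Psi> term real, and Fenchel-Young then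
  compares the iterate with an arbitrary \<open>r\<close>.\<close>

lemma stability_bound:
  assumes h: "h @ [x] \<in> histories \<G>" "length h < n" and r: "r \<in> D"
  shows "\<eta> * ((Q h - r) \<bullet> estimate h x) - stability h x \<le> divergence r (Q h)"
proof -
  obtain a z where x: "h \<in> histories \<G>" "a \<in> actions \<G>" "z \<in> latent \<G>" "x = (a, signal \<G> a z)"
    using h(1) unfolding histories_snoc by blast
  note it = iterate[OF x(1) h(2)]
  have "\<bar>Psi F (Q h) (\<eta> *\<^sub>R estimate h x)\<bar> \<noteq> \<infinity>"
    using Lambda_real(1)[OF legendre_potential it(2) \<eta> finite_actions it(3) Lambda_bound[OF x(1) h(2) x(3) r] x(2)]
    by (simp add: loss_estimate_def x(4))
  moreover have "ereal ((Q h - r) \<bullet> (\<eta> *\<^sub>R estimate h x) - divergence r (Q h)) \<le> Psi F (Q h) (\<eta> *\<^sub>R estimate h x)"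
    using r domain_subset_edom by (intro Psi_lower_bound[OF legendre_potential it(2)]) auto
  ultimately have "(Q h - r) \<bullet> (\<eta> *\<^sub>R estimate h x) - divergence r (Q h) \<le> stability h x"
    by (cases "Psi F (Q h) (\<eta> *\<^sub>R estimate h x)") auto
  then show ?thesis by simp
qed

text \<open>Both updates minimise <q, v> + F(q) over \<open>D\<close> for this vector v. In mirror
  descent the linear part of the Bregman divergence is absorbed into it.\<close>

definition update_direction :: "('d, 's) history \<Rightarrow> (real ^ 'd) \<times> 's \<Rightarrow> real ^ 'd" where
  "update_direction h x = (case u of
     MD \<Rightarrow> \<eta> *\<^sub>R estimate h x - grad F (Q h)
   | FTRL \<Rightarrow> \<eta> *\<^sub>R history_sum estimate (h @ [x]))"

lemma update_minimises:
  assumes h: "h @ [x] \<in> histories \<G>" "length h < n" and q: "q \<in> D"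
  shows "Q (h @ [x]) \<bullet> update_direction h x + rval F (Q (h @ [x])) \<le> q \<bullet> update_direction h x + rval F q"
proof -
  obtain a z where x: "h \<in> histories \<G>" "a \<in> actions \<G>" "z \<in> latent \<G>" "x = (a, signal \<G> a z)"
    using h(1) unfolding histories_snoc by blast
  define obj where "obj = update_objective u F \<eta> P E Q h (fst x) (snd x)"
  have "is_arg_min obj (\<lambda>q. q \<in> D) (Q (h @ [x]))"
    using algorithm x h(2) unfolding exploration_by_optimisation_def obj_def by auto
  then have Q': "Q (h @ [x]) \<in> D" and le: "obj (Q (h @ [x])) \<le> obj q"
    using q unfolding is_arg_min_def by (auto simp: not_less)
  \<comment> \<open>On \<open>D\<close> the extended-real objective is a real one, rescaled by
    \<eta> and shifted by a constant, so the minimisers agree.\<close>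
  have obj: "\<exists>c. \<forall>y\<in>D. obj y = ereal ((y \<bullet> update_direction h x + rval F y) / \<eta> + c)"
  proof (cases u)
    case MD
    have "obj y = ereal ((y \<bullet> update_direction h x + rval F y) / \<eta> + (grad F (Q h) \<bullet> Q h - rval F (Q h)) / \<eta>)"
      if y: "y \<in> D" for y
    proof -
      have "bregman F y (Q h) = ereal (divergence y (Q h))"
        using y domain_subset_edom iterate(2)[OF x(1) h(2)] by (intro bregman_real[OF legendre_potential]) auto
      then have "obj y = ereal (y \<bullet> estimate h x + 1 / \<eta> * divergence y (Q h))"
        unfolding obj_def MD by simp
      also have "y \<bullet> estimate h x + 1 / \<eta> * divergence y (Q h) =
          (y \<bullet> update_direction h x + rval F y) / \<eta> + (grad F (Q h) \<bullet> Q h - rval F (Q h)) / \<eta>"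
        unfolding update_direction_def unfolding MD using \<eta>
        by (simp add: inner_diff_right inner_commute add_divide_distrib diff_divide_distrib)
      finally show ?thesis .
    qed
    then show ?thesis by blast
  next
    case FTRL
    have "obj y = ereal ((y \<bullet> update_direction h x + rval F y) / \<eta> + 0)" if y: "y \<in> D" for y
    proof -
      obtain r where r: "F y = ereal r" using legendre_edomE[OF legendre_potential] y domain_subset_edom by blast
      have "obj y = ereal (y \<bullet> history_sum estimate (h @ [x])) + F y / ereal \<eta>"
        unfolding obj_def FTRL history_sum_def by (simp add: Let_def inner_sum_right inner_add_right)
      then show ?thesis
        unfolding update_direction_def unfolding FTRL r using \<eta> by (simp add: add_divide_distrib)
    qed
    then show ?thesis by blast
  qed
  then obtain c where "\<forall>y\<in>D. obj y = ereal ((y \<bullet> update_direction h x + rval F y) / \<eta> + c)" by blast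
  with le Q' q show ?thesis using \<eta> by (simp add: divide_le_cancel)
qed

text \<open>The gradient at the new iterate must exist, hence \<open>Suc (length h) < n\<close>: the
  iterate after the last round may lie outside \<open>dom_grad F\<close>.\<close>

lemma update_optimality:
  assumes h: "h @ [x] \<in> histories \<G>" "Suc (length h) < n" and b: "b \<in> D"
  shows "Q (h @ [x]) \<bullet> update_direction h x + rval F (Q (h @ [x])) + divergence b (Q (h @ [x]))
    \<le> b \<bullet> update_direction h x + rval F b"
  using iterate[OF h(1)] h b update_minimises[OF h(1)]
  by (intro first_order_optimality[OF legendre_potential convex_domain domain_subset_edom]) auto

text \<open>These are the terms of \<Lambda> other than the loss, evaluated at the sampled actions.
  They are bounded below on every path and, together with the loss, above in expectation.\<close>

definition stable_estimates :: "real ^ 'd \<Rightarrow> ('d, 's) history \<Rightarrow> real" where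
  "stable_estimates b = history_sum (\<lambda>h x. (b - Q h) \<bullet> estimate h x + stability h x / \<eta>)"

text \<open>Separates the dependence on \<open>b\<close>, which allows the comparator to be changed
  in the step for the regularised leader.\<close>

lemma stable_estimates_split:
  "\<eta> * stable_estimates b h = \<eta> * (b \<bullet> history_sum estimate h) -
     history_sum (\<lambda>h x. \<eta> * (Q h \<bullet> estimate h x) - stability h x) h"
  using \<eta> unfolding stable_estimates_def
  by (induction h rule: rev_induct) (simp_all add: inner_diff_left inner_add_right algebra_simps)

text \<open>The same potential works for both updates. The mirror descent step uses the induction
  hypothesis at \<open>b\<close>, the regularised leader step uses it at the new iterate.\<close>

lemma potential_invariant:
  assumes "h \<in> histories \<G>" "length h < n" "b \<in> D"
  shows "divergence b (Q h) - \<eta> * stable_estimates b h \<le> rval F b - rval F (Q [])"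
  using assms
proof (induction h arbitrary: b rule: rev_induct)
  case Nil
  have min: "is_arg_min F (\<lambda>q. q \<in> D) (Q [])"
    using algorithm unfolding exploration_by_optimisation_def by blast
  have "rval F (Q []) \<le> rval F y" if y: "y \<in> D" for y
  proof -
    have "F (Q []) \<le> F y" using min y unfolding is_arg_min_def by (auto simp: not_less)
    moreover obtain r where "F (Q []) = ereal r"
      using legendre_edomE[OF legendre_potential subsetD[OF domain_subset_edom iterate(1)[OF Nil(1,2)]]] .
    moreover obtain s where "F y = ereal s"
      using legendre_edomE[OF legendre_potential subsetD[OF domain_subset_edom y]] .
    ultimately show ?thesis by simp
  qed
  \<comment> \<open>The first iterate minimises F alone, so the optimality condition is used with
    direction 0.\<close>
  then have "Q [] \<bullet> 0 + rval F (Q []) + divergence b (Q []) \<le> b \<bullet> 0 + rval F b"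
    using iterate[OF Nil(1,2)] Nil(3)
    by (intro first_order_optimality[OF legendre_potential convex_domain domain_subset_edom]) auto
  then show ?case by (simp add: stable_estimates_def)
next
  case (snoc x h)
  have h: "h \<in> histories \<G>" "length h < n" using snoc.prems(1,2) by (auto simp: histories_snoc)
  let ?q = "Q (h @ [x])"
  have q: "?q \<in> D" using iterate(1)[OF snoc.prems(1,2)] .
  have stab: "\<eta> * ((Q h - ?q) \<bullet> estimate h x) - stability h x \<le> divergence ?q (Q h)"
    by (rule stability_bound[OF snoc.prems(1) h(2) q])
  have opt: "?q \<bullet> update_direction h x + rval F ?q + divergence b ?q \<le> b \<bullet> update_direction h x + rval F b"
    using snoc.prems by (intro update_optimality) auto
  show ?case
  proof (cases u)
    case MD
    \<comment> \<open>The three-point inequality of mirror descent.\<close>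
    have "\<eta> * ((?q - b) \<bullet> estimate h x) + divergence ?q (Q h) + divergence b ?q \<le> divergence b (Q h)"
      using opt unfolding update_direction_def unfolding MD
      by (simp add: inner_diff_right inner_diff_left inner_commute algebra_simps)
    moreover have "divergence b (Q h) - \<eta> * stable_estimates b h \<le> rval F b - rval F (Q [])"
      by (rule snoc.IH[OF h snoc.prems(3)])
    moreover have "\<eta> * stable_estimates b (h @ [x]) =
        \<eta> * stable_estimates b h + (\<eta> * ((b - Q h) \<bullet> estimate h x) + stability h x)"
      unfolding stable_estimates_def using \<eta> by (simp add: distrib_left)
    ultimately show ?thesis using stab by (simp add: inner_diff_left algebra_simps)
  next
    case FTRL
    \<comment> \<open>The new leader is the comparator for the past, which is why \<open>b\<close>
      is generalised; the divergence on the left pays for the stability of the step.\<close>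
    have "divergence ?q (Q h) - \<eta> * stable_estimates ?q h \<le> rval F ?q - rval F (Q [])"
      by (rule snoc.IH[OF h q])
    moreover have "\<eta> * (?q \<bullet> history_sum estimate (h @ [x])) + rval F ?q + divergence b ?q \<le>
        \<eta> * (b \<bullet> history_sum estimate (h @ [x])) + rval F b"
      using opt unfolding update_direction_def unfolding FTRL by simp
    ultimately show ?thesis using stab
      unfolding stable_estimates_split by (simp add: inner_diff_left inner_add_right algebra_simps)
  qed
qed

text \<open>The potential is used just before the last round. That round is closed by the stability
  bound at \<open>b\<close> itself, so no gradient at the final iterate enters.\<close>

lemma stable_estimates_lower_bound:
  assumes h: "h \<in> histories \<G>" "length h = n" and "1 \<le> n" and b: "b \<in> D"
  shows "- (rval F b - rval F (Q [])) / \<eta> \<le> stable_estimates b h"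
proof -
  obtain h' x where hx: "h = h' @ [x]" using h(2) \<open>1 \<le> n\<close> by (cases h rule: rev_cases) auto
  have h': "h' \<in> histories \<G>" "length h' < n" "h' @ [x] \<in> histories \<G>"
    using h unfolding hx histories_snoc by auto
  have "\<eta> * stable_estimates b h =
      \<eta> * stable_estimates b h' + (\<eta> * ((b - Q h') \<bullet> estimate h' x) + stability h' x)"
    unfolding stable_estimates_def hx using \<eta> by (simp add: distrib_left)
  then have "- (rval F b - rval F (Q [])) \<le> \<eta> * stable_estimates b h"
    using potential_invariant[OF h'(1,2) b] stability_bound[OF h'(3,2) b]
    by (simp add: inner_diff_left algebra_simps)
  then show ?thesis using \<eta> by (simp add: pos_divide_le_eq mult.commute)
qed

section \<open>Expectations over the random history\<close>

lemma history_pmf_support: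
  assumes z: "\<forall>t\<in>{1..n}. z t \<in> latent \<G>" and "t \<le> n"
  shows "h \<in> set_pmf (history_pmf \<G> P z t) \<Longrightarrow> h \<in> histories \<G> \<and> length h = t"
    and "finite (set_pmf (history_pmf \<G> P z t))"
proof -
  have "finite (set_pmf (history_pmf \<G> P z t)) \<and>
      (\<forall>h\<in>set_pmf (history_pmf \<G> P z t). h \<in> histories \<G> \<and> length h = t)"
    using \<open>t \<le> n\<close>
  proof (induction t)
    case (Suc t)
    then have IH: "finite (set_pmf (history_pmf \<G> P z t))"
      "\<And>h. h \<in> set_pmf (history_pmf \<G> P z t) \<Longrightarrow> h \<in> histories \<G> \<and> length h = t" by auto
    have set: "set_pmf (P h) = actions \<G>" if "h \<in> set_pmf (history_pmf \<G> P z t)" for h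
      using IH(2)[OF that] Suc.prems iterate(3) by auto
    have "z (Suc t) \<in> latent \<G>" using z Suc.prems by auto
    then show ?case using IH set finite_actions by (auto simp: histories_snoc)
  qed simp
  then show "h \<in> set_pmf (history_pmf \<G> P z t) \<Longrightarrow> h \<in> histories \<G> \<and> length h = t"
    and "finite (set_pmf (history_pmf \<G> P z t))" by auto
qed

text \<open>Conditionally on the history, the expected increment is the average in
  \<open>Lambda_real\<close> at target \<open>b\<close> and the next latent state, hence at most
  \<open>C\<close>.\<close>

lemma expected_bound:
  assumes z: "\<forall>t\<in>{1..n}. z t \<in> latent \<G>" and b: "b \<in> D" and "t \<le> n"
  shows "measure_pmf.expectation (history_pmf \<G> P z t)
    (\<lambda>h. history_sum (\<lambda>h x. (fst x - b) \<bullet> loss \<G> (z (Suc (length h)))) h + stable_estimates b h) \<le> real t * C"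
  using \<open>t \<le> n\<close>
proof (induction t)
  case 0
  then show ?case by (simp add: stable_estimates_def)
next
  case (Suc t)
  define G where "G h x = (fst x - b) \<bullet> loss \<G> (z (Suc (length h))) +
    ((b - Q h) \<bullet> estimate h x + stability h x / \<eta>)" for h x
  have G: "history_sum (\<lambda>h x. (fst x - b) \<bullet> loss \<G> (z (Suc (length h)))) h + stable_estimates b h =
      history_sum G h" for h
    unfolding stable_estimates_def G_def history_sum_def by (simp add: sum.distrib)
  define M where "M = history_pmf \<G> P z t"
  note sup = history_pmf_support[OF z, of t, folded M_def]
  have t: "t < n" using Suc.prems by simp
  have finM: "finite (set_pmf M)" using sup(2) t by simp
  have hM: "h \<in> histories \<G>" "length h < n" "length h = t" if "h \<in> set_pmf M" for h
    using sup(1) that t by auto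
  have zt: "z (Suc t) \<in> latent \<G>" using z t by auto
  have step: "measure_pmf.expectation (map_pmf (\<lambda>a. h @ [(a, signal \<G> a (z (Suc t)))]) (P h)) (history_sum G)
      \<le> history_sum G h + C" if h: "h \<in> set_pmf M" for h
  proof -
    note it = iterate[OF hM(1,2)[OF h]]
    have "measure_pmf.expectation (map_pmf (\<lambda>a. h @ [(a, signal \<G> a (z (Suc t)))]) (P h)) (history_sum G) =
        (\<Sum>a\<in>actions \<G>. pmf (P h) a * (history_sum G h + G h (a, signal \<G> a (z (Suc t)))))"
      by (subst integral_map_pmf, subst expectation_finite) (use it(3) finite_actions in auto)
    also have "\<dots> = history_sum G h + (\<Sum>a\<in>actions \<G>. pmf (P h) a * G h (a, signal \<G> a (z (Suc t))))"
      using sum_pmf_eq_1[OF finite_actions, of "P h"] it(3)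
      by (simp add: distrib_left sum.distrib flip: sum_distrib_right)
    also have "\<dots> \<le> history_sum G h + C"
      using Lambda_real(2)[OF legendre_potential it(2) \<eta> finite_actions it(3) Lambda_bound[OF hM(1,2)[OF h] zt b]] hM(3)[OF h]
      by (simp add: G_def loss_estimate_def)
    finally show ?thesis .
  qed
  have "measure_pmf.expectation (history_pmf \<G> P z (Suc t)) (history_sum G) =
      (\<Sum>h\<in>set_pmf M. pmf M h *\<^sub>R measure_pmf.expectation
        (map_pmf (\<lambda>a. h @ [(a, signal \<G> a (z (Suc t)))]) (P h)) (history_sum G))"
    unfolding history_pmf.simps M_def[symmetric]
    using finM iterate(3)[OF hM(1,2)] finite_actions by (intro pmf_expectation_bind) auto
  also have "\<dots> \<le> (\<Sum>h\<in>set_pmf M. pmf M h * (history_sum G h + C))"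
    unfolding real_scaleR_def by (intro sum_mono mult_left_mono step) auto
  also have "\<dots> = measure_pmf.expectation M (history_sum G) + C"
    unfolding expectation_finite[OF finM] using sum_pmf_eq_1[OF finM subset_refl]
    by (simp add: distrib_left sum.distrib flip: sum_distrib_right)
  also have "\<dots> \<le> real t * C + C" using Suc unfolding G M_def by simp
  finally show ?case unfolding G by (simp add: algebra_simps)
qed

text \<open>Replacing the comparator \<open>a\<close> by \<open>b\<close> in \<open>D\<close> costs
  at most \<open>g\<close> per round. The loss against \<open>b\<close> is then its sum with the
  stable estimates, bounded in expectation, minus the stable estimates, bounded on every
  path.\<close>

lemma expected_regret_bound:
  assumes z: "\<forall>t\<in>{1..n}. z t \<in> latent \<G>" and b: "b \<in> D" and n: "1 \<le> n"
    and gap: "\<And>y. y \<in> latent \<G> \<Longrightarrow> (b - a) \<bullet> loss \<G> y \<le> g"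
  shows "measure_pmf.expectation (history_pmf \<G> P z n)
      (\<lambda>h. \<Sum>t=1..n. (fst (h ! (t - 1)) - a) \<bullet> loss \<G> (z t))
    \<le> (C + g) * real n + (rval F b - rval F (Q [])) / \<eta>"
proof -
  define M where "M = history_pmf \<G> P z n"
  note sup = history_pmf_support[OF z order_refl, folded M_def]
  let ?L = "\<lambda>h. history_sum (\<lambda>h x. (fst x - b) \<bullet> loss \<G> (z (Suc (length h)))) h"
  let ?d = "(rval F b - rval F (Q [])) / \<eta>"
  have "(\<Sum>t=1..n. (fst (h ! (t - 1)) - a) \<bullet> loss \<G> (z t)) \<le> ?L h + stable_estimates b h + (?d + real n * g)"
    if h: "h \<in> set_pmf M" for h
  proof -
    have len: "length h = n" using sup(1)[OF h] by simp
    have "(\<Sum>t=1..n. (fst (h ! (t - 1)) - a) \<bullet> loss \<G> (z t)) =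
        (\<Sum>s<n. (fst (h ! s) - a) \<bullet> loss \<G> (z (Suc s)))"
      by (simp add: sum.atLeast1_atMost_eq)
    also have "\<dots> = (\<Sum>s<n. (fst (h ! s) - b) \<bullet> loss \<G> (z (Suc s))) + (\<Sum>s<n. (b - a) \<bullet> loss \<G> (z (Suc s)))"
      unfolding sum.distrib[symmetric] by (simp flip: inner_add_left)
    also have "(\<Sum>s<n. (fst (h ! s) - b) \<bullet> loss \<G> (z (Suc s))) = ?L h"
      unfolding history_sum_def len by (intro sum.cong) (auto simp: len)
    also have "(\<Sum>s<n. (b - a) \<bullet> loss \<G> (z (Suc s))) \<le> (\<Sum>s<n. g)"
      using z by (intro sum_mono gap) auto
    also have "(\<Sum>s<n. g) = real n * g" by simp
    finally show ?thesis
      using stable_estimates_lower_bound[OF _ len n b] sup(1)[OF h]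
      unfolding minus_divide_left[symmetric] by linarith
  qed
  then have "measure_pmf.expectation M (\<lambda>h. \<Sum>t=1..n. (fst (h ! (t - 1)) - a) \<bullet> loss \<G> (z t)) \<le>
      (\<Sum>h\<in>set_pmf M. pmf M h * (?L h + stable_estimates b h + (?d + real n * g)))"
    unfolding expectation_finite[OF sup(2)] real_scaleR_def by (intro sum_mono mult_left_mono) auto
  also have "\<dots> = measure_pmf.expectation M (\<lambda>h. ?L h + stable_estimates b h) + (?d + real n * g)"
    unfolding expectation_finite[OF sup(2)] using sum_pmf_eq_1[OF sup(2) subset_refl]
    by (simp add: distrib_left[of _ _ "?d + real n * g"] sum.distrib flip: sum_distrib_right)
  also have "\<dots> \<le> real n * C + (?d + real n * g)"
    using expected_bound[OF z b order_refl] unfolding M_def by simp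
  finally show ?thesis unfolding M_def by (simp add: algebra_simps)
qed

end

section \<open>Tuning and the choice of the comparator\<close>

lemma tuned_rate_sum:
  fixes d m lam :: real
  assumes "0 < d" "0 < m" "1 < lam"
  shows "(1 - 1 / lam) * m * (d / m) powr (1 / lam) + d / (lam * (d / m) powr (1 - 1 / lam)) =
    d powr (1 / lam) * m powr (1 - 1 / lam)"
proof -
  \<comment> \<open>Both summands are multiples of the same quantity, with factors
    \<open>1 - 1 / lam\<close> and \<open>1 / lam\<close>.\<close>
  have 1: "m * (d / m) powr (1 / lam) = d powr (1 / lam) * m powr (1 - 1 / lam)"
    using assms by (simp add: powr_divide powr_diff)
  have "d / (d / m) powr (1 - 1 / lam) = d powr (1 / lam) * m powr (1 - 1 / lam)"
    using assms by (simp add: powr_divide powr_diff)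
  then have 2: "d / (lam * (d / m) powr (1 - 1 / lam)) = 1 / lam * (d powr (1 / lam) * m powr (1 - 1 / lam))"
    by (simp add: divide_divide_eq_left[symmetric] mult.commute[of lam] del: divide_divide_eq_left)
  show ?thesis unfolding 2 mult.assoc 1 by (simp add: algebra_simps)
qed

text \<open>A near-minimiser exists by the definition of the infimum alone; the slack \<delta> is
  removed at the end by letting it tend to 0.\<close>

lemma domain_gap_witness:
  fixes \<G> :: "('d::finite, 'z, 's) pm_game"
  assumes S: "standing_assumptions \<G> F D" and "D \<noteq> {}" and a: "a \<in> actions \<G>" and "0 < \<delta>"
  obtains b where "b \<in> D" "\<And>y. y \<in> latent \<G> \<Longrightarrow> (b - a) \<bullet> loss \<G> y \<le> domain_gap \<G> D + \<delta>"
proof -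
  define f where "f b = (SUP z\<in>latent \<G>. (b - a) \<bullet> loss \<G> z)" for b
  have "(INF b\<in>D. f b) \<le> domain_gap \<G> D"
    unfolding domain_gap_def f_def using S a unfolding standing_assumptions_def by (intro Max_ge) auto
  moreover have "\<exists>b\<in>D. f b < (INF b\<in>D. f b) + \<delta>"
  proof (rule ccontr)
    assume "\<not> ?thesis"
    then have "(INF b\<in>D. f b) + \<delta> \<le> (INF b\<in>D. f b)"
      using \<open>D \<noteq> {}\<close> by (intro cINF_greatest) (auto simp: not_less)
    then show False using \<open>0 < \<delta>\<close> by simp
  qed
  ultimately obtain b where b: "b \<in> D" "f b \<le> domain_gap \<G> D + \<delta>" by force
  have "(b - a) \<bullet> loss \<G> y \<le> f b" if "y \<in> latent \<G>" for y
    unfolding f_def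
  proof (rule cSUP_upper[OF that])
    have "(b - a) \<bullet> loss \<G> z \<le> 1" if "z \<in> latent \<G>" for z
      using loss_difference_bounds(1)[OF S a b(1) that] by (simp add: inner_diff_left)
    then show "bdd_above ((\<lambda>z. (b - a) \<bullet> loss \<G> z) ` latent \<G>)" by (auto intro!: bdd_aboveI[of _ 1])
  qed
  with b show ?thesis by (intro that[of b]) force+
qed

theorem corollary10:
  fixes \<G> :: "('d::finite, 'z, 's) pm_game"
    and F :: "real ^ 'd \<Rightarrow> ereal"
    and D :: "(real ^ 'd) set"
    and \<alpha> \<beta> lam \<epsilon> \<eta> :: real
    and n :: nat
    and u :: update_rule
    and P :: "('d, 's) history \<Rightarrow> (real ^ 'd) pmf"
    and E :: "('d, 's) history \<Rightarrow> real ^ 'd \<Rightarrow> 's \<Rightarrow> real ^ 'd"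
    and Q :: "('d, 's) history \<Rightarrow> real ^ 'd"
    and z :: "nat \<Rightarrow> 'z"
  assumes "linear_pm_game \<G>"
    and "standing_assumptions \<G> F D"
    and "has_information_ratio \<G> F D \<alpha> \<beta> lam"
    and "lam > 1" and "\<beta> > 0" and "potential_diam F D > 0"
    and "n \<ge> 1" and "\<epsilon> > 0"
    and "\<eta> = lam * (real_of_ereal (potential_diam F D) / (\<beta> * real n)) powr (1 - 1 / lam)"
    and "exploration_by_optimisation \<G> F D u n \<eta> \<epsilon> P E Q"
    and "\<forall>t\<in>{1..n}. z t \<in> latent \<G>"
  shows "regret \<G> P z n \<le> (\<epsilon> + domain_gap \<G> D + \<alpha>) * real n
           + real_of_ereal (potential_diam F D) powr (1 / lam) * (\<beta> * real n) powr (1 - 1 / lam)"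
proof -
  let ?A = "actions \<G>"
  define d where "d = real_of_ereal (potential_diam F D)"
  have S: "standing_assumptions \<G> F D" by (rule assms)
  have dF: "potential_diam F D = ereal d" and d: "0 < d"
    using S assms(6) unfolding standing_assumptions_def d_def by (cases "potential_diam F D"; simp)+
  have n: "0 < real n" using assms(7) by simp
  define r where "r = d / (\<beta> * real n)"
  have r: "0 < r" unfolding r_def using d n assms(5) by simp
  have \<eta>: "\<eta> = lam * r powr (1 - 1 / lam)" using assms(9) unfolding r_def d_def .
  have \<eta>_pos: "0 < \<eta>" unfolding \<eta> using assms(4) r by simp
  define c where "c = (1 - 1 / lam) * \<beta> * r powr (1 / lam)"
  have bound: "Lambda_sup \<G> F D (Q h) \<eta> (P h) (E h) \<le> ereal (\<alpha> + c + \<epsilon>)"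
    if "h \<in> histories \<G>" "length h < n" for h
  proof -
    have "Lambda_sup \<G> F D (Q h) \<eta> (P h) (E h) \<le> Lambda_star \<G> F D \<eta> + ereal \<epsilon>"
      using assms(10) that unfolding exploration_by_optimisation_def by blast
    also have "\<dots> \<le> ereal (\<alpha> + c) + ereal \<epsilon>"
      unfolding c_def by (intro add_right_mono Lambda_star_le[OF S assms(3,4,5) r \<eta>])
    finally show ?thesis by simp
  qed
  have Q: "Q [] \<in> D" using assms(10) unfolding exploration_by_optimisation_def is_arg_min_def by blast
  have diam: "rval F b - rval F (Q []) \<le> d" if b: "b \<in> D" for b
  proof -
    have "F b - F (Q []) \<le> potential_diam F D"
      unfolding potential_diam_def using b Q by (intro SUP_upper2[of b] SUP_upper2[of "Q []"]) auto
    moreover have F: "legendre F" and "D \<subseteq> edom F" using S unfolding standing_assumptions_def by auto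
    moreover obtain s where "F b = ereal s"
      using legendre_edomE[OF F subsetD[OF \<open>D \<subseteq> edom F\<close> b]] .
    moreover obtain t where "F (Q []) = ereal t"
      using legendre_edomE[OF F subsetD[OF \<open>D \<subseteq> edom F\<close> Q]] .
    ultimately show ?thesis unfolding dF by simp
  qed
  have "measure_pmf.expectation (history_pmf \<G> P z n)
      (\<lambda>h. \<Sum>t=1..n. (fst (h ! (t - 1)) - a) \<bullet> loss \<G> (z t)) \<le>
      (\<alpha> + c + \<epsilon> + domain_gap \<G> D) * real n + d / \<eta>" if a: "a \<in> ?A" for a
  proof (rule field_le_epsilon)
    fix e :: real assume "0 < e"
    \<comment> \<open>The slack is incurred in each of the \<open>n\<close> rounds and so adds up to
      \<open>e\<close>.\<close>
    then have "0 < e / real n" using n by simp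
    then obtain b where b: "b \<in> D"
      "\<And>y. y \<in> latent \<G> \<Longrightarrow> (b - a) \<bullet> loss \<G> y \<le> domain_gap \<G> D + e / real n"
      using domain_gap_witness[OF S _ a] Q by blast
    have "measure_pmf.expectation (history_pmf \<G> P z n)
        (\<lambda>h. \<Sum>t=1..n. (fst (h ! (t - 1)) - a) \<bullet> loss \<G> (z t)) \<le>
        (\<alpha> + c + \<epsilon> + (domain_gap \<G> D + e / real n)) * real n + (rval F b - rval F (Q [])) / \<eta>"
      by (rule expected_regret_bound[OF S \<eta>_pos assms(10) bound assms(11) b(1) assms(7) b(2)])
    also have "\<dots> \<le> (\<alpha> + c + \<epsilon> + (domain_gap \<G> D + e / real n)) * real n + d / \<eta>"
      using diam[OF b(1)] \<eta>_pos by (simp add: divide_right_mono)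
    also have "\<dots> = (\<alpha> + c + \<epsilon> + domain_gap \<G> D) * real n + d / \<eta> + e"
      using n by (simp add: distrib_right)
    finally show "measure_pmf.expectation (history_pmf \<G> P z n)
        (\<lambda>h. \<Sum>t=1..n. (fst (h ! (t - 1)) - a) \<bullet> loss \<G> (z t)) \<le>
        (\<alpha> + c + \<epsilon> + domain_gap \<G> D) * real n + d / \<eta> + e" .
  qed
  moreover have "finite ?A" "?A \<noteq> {}" using S unfolding standing_assumptions_def by auto
  ultimately have "regret \<G> P z n \<le> (\<alpha> + c + \<epsilon> + domain_gap \<G> D) * real n + d / \<eta>"
    unfolding regret_def by (intro Max.boundedI) auto
  also have "\<dots> = (\<epsilon> + domain_gap \<G> D + \<alpha>) * real n + (c * real n + d / \<eta>)"
    by (simp add: algebra_simps)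
  also have "c * real n + d / \<eta> = d powr (1 / lam) * (\<beta> * real n) powr (1 - 1 / lam)"
    using tuned_rate_sum[of d "\<beta> * real n" lam] d n assms(4,5)
    unfolding c_def \<eta> r_def by (simp add: mult_ac)
  finally show ?thesis unfolding d_def .
qed

end
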